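(* Let $(X,\mathcal A,\mu)$ be a probability space, let $V_n\subset L^2(X,\mu)$ be a subspace of dimension $n\geq2$, and let $f:X\to\mathbb C$ be measurable. Let $x_1,\dots,x_n$ be the random points selected by Algorithm B (defined in the context) with $m=n$ and input $\delta=\sqrt{1-1/n}$, and let $\tilde f=P_n^nf\in V_n$ be the interpolation of $f$ at $x_1,\dots,x_n$. If $\kappa=0$, then $$\mathbb E\big(\|f-\tilde f\|_{L^2}^2\big)\leq(4n^2+1)\min_{v\in V_n}\|f-v\|_{L^2}^2 .$$ If $\kappa=1$ and $V_n\subset L^\infty(X,\mu)$, then $$\|f-\tilde f\|_{L^2}\leq(2n+1)\min_{v\in V_n}\|f-v\|_{L^\infty}\qquad\text{almost surely.}$$
   Context: Notation. $\|g\|_{L^2}=(\int_X|g|^2\,d\mu)^{1/2}$ and $\|\cdot\|_{L^\infty}$ is the essential supremum norm of $L^\infty(X,\mu)$; norms may equal $+\infty$. $\varphi=(\varphi_1,\dots,\varphi_n)$ is an orthonormal basis of $V_n$ in $L^2(X,\mu)$ (with fixed pointwise representatives); $\varphi(x)$ is viewed as a column vector in $\mathbb C^n$, $\varphi(x)^*$ is its conjugate transpose. $I$ is the $n\times n$ identity matrix and $\operatorname{Tr}$ is the trace. Given points $x_1,\dots,x_m\in X$ and weights $s_1,\dots,s_m>0$, $P_n^mf\in\operatorname{arg\,min}_{v\in V_n}\sum_{i=1}^m s_i|f(x_i)-v(x_i)|^2$, the minimizer being unique when $A_m=\sum_{i=1}^m s_i\varphi(x_i)\varphi(x_i)^*$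 is invertible. When $m=n$ and $A_n$ is invertible, $P_n^nf$ is the unique element of $V_n$ with $P_n^nf(x_i)=f(x_i)$ for $i=1,\dots,n$, and it does not depend on the weights. Algorithm B (inputs: $\mu$, $\delta\in(0,1)$, $\kappa\in[0,1]$). Start with $A_0=0\in\mathbb R^{n\times n}$, $\ell_0=-n$. For $i=1,\dots,m$: let $Y_i=(A_{i-1}-\ell_{i-1}I)^{-1}$, $\ell_i=\ell_{i-1}+\delta$, $Z_i=(A_{i-1}-\ell_iI)^{-1}$, $W_i=\big(\operatorname{Tr}(Z_i)-\operatorname{Tr}(Y_i)\big)^{-1}Z_i^2-Z_i$, $w_i(x)=\varphi(x)^*W_i\varphi(x)$; let $R_i(x)=w_i(x)$ if $w_i(x)\geq\kappa\frac{1-\delta}{\delta}$ and $R_i(x)=0$ otherwise, and $\Gamma_i=\int_XR_i\,d\mu$; conditionally on $x_1,\dots,x_{i-1}$, draw $x_i$ from the probability measure $\frac{R_i(x)}{\Gamma_i}\,d\mu(x)$; let $s_i=1/R_i(x_i)=1/w_i(x_i)$ and $A_i=A_{i-1}+s_i\varphi(x_i)\varphi(x_i)^*$. Output: points $x_1,\dots,x_m$, weights $s_1,\dots,s_m$, matrix $A_m$. *)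

theory Defs
  imports "HOL-Probability.Probability"
begin

section \<open>Norms and subspaces of $L^2$\<close>

text \<open>Both norms take values in \<^typ>\<open>ennreal\<close>, so that they may be infinite. They are meant for
  measurable arguments.\<close>

definition L2norm :: "'a measure \<Rightarrow> ('a \<Rightarrow> complex) \<Rightarrow> ennreal" where
  "L2norm M g =
     (let I = (\<integral>\<^sup>+ x. ennreal ((cmod (g x))\<^sup>2) \<partial>M)
      in if I = \<infinity> then \<infinity> else ennreal (sqrt (enn2real I)))"

definition Linfnorm :: "'a measure \<Rightarrow> ('a \<Rightarrow> complex) \<Rightarrow> ennreal" where
  "Linfnorm M g = esssup M (\<lambda>x. ennreal (cmod (g x)))"

definition L2_funs :: "'a measure \<Rightarrow> ('a \<Rightarrow> complex) set" where
  "L2_funs M = {g \<in> borel_measurable M. L2norm M g < \<infinity>}"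

definition Linf_funs :: "'a measure \<Rightarrow> ('a \<Rightarrow> complex) set" where
  "Linf_funs M = {g \<in> borel_measurable M. Linfnorm M g < \<infinity>}"

text \<open>$L^2$ consists of classes of functions modulo equality almost everywhere; a subspace of it is
  represented by the set of all representatives of its elements, hence the last clause.\<close>

definition L2_subspace :: "'a measure \<Rightarrow> ('a \<Rightarrow> complex) set \<Rightarrow> bool" where
  "L2_subspace M V \<longleftrightarrow>
     V \<subseteq> L2_funs M \<and>
     (\<lambda>_. 0) \<in> V \<and>
     (\<forall>g\<in>V. \<forall>h\<in>V. (\<lambda>x. g x + h x) \<in> V) \<and>
     (\<forall>c. \<forall>g\<in>V. (\<lambda>x. c * g x) \<in> V) \<and>
     (\<forall>g\<in>V. \<forall>h\<in>borel_measurable M. (AE x in M. h x = g x) \<longrightarrow> h \<in> V)"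

text \<open>A family $\varphi_1,\dots,\varphi_n$ of functions with fixed pointwise values is given as one
  map into \<^typ>\<open>complex ^ 'n\<close> with \<open>n = CARD('n)\<close>. If it is an orthonormal basis of \<open>V\<close>, then \<open>V\<close>
  has dimension \<open>CARD('n)\<close>.\<close>

definition lin_comb :: "('a \<Rightarrow> complex ^ 'n) \<Rightarrow> complex ^ 'n \<Rightarrow> 'a \<Rightarrow> complex" where
  "lin_comb \<phi> c = (\<lambda>x. \<Sum>j\<in>UNIV. c $ j * \<phi> x $ j)"

definition orthonormal_basis ::
  "'a measure \<Rightarrow> ('a \<Rightarrow> complex) set \<Rightarrow> ('a \<Rightarrow> complex ^ 'n) \<Rightarrow> bool" where
  "orthonormal_basis M V \<phi> \<longleftrightarrow>
     (\<forall>j. (\<lambda>x. \<phi> x $ j) \<in> V) \<and>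
     (\<forall>j k. (\<integral>x. \<phi> x $ j * cnj (\<phi> x $ k) \<partial>M) = (if j = k then 1 else 0)) \<and>
     (\<forall>v\<in>V. \<exists>c. AE x in M. v x = lin_comb \<phi> c x)"


section \<open>Weighted least squares\<close>

text \<open>Point evaluations of elements of \<open>V\<close> refer to the representatives fixed by the basis, so the
  minimization ranges over the pointwise linear combinations of \<open>\<phi>\<close>. A minimizer always exists; it
  is unique, and for \<open>m = CARD('n)\<close> interpolates \<open>f\<close> at the points, when the matrix
  $\sum_i s_i\varphi(x_i)\varphi(x_i)^*$ is invertible. Points are numbered from \<open>0\<close>.\<close>

definition weighted_lsq ::
  "('a \<Rightarrow> complex ^ 'n) \<Rightarrow> nat \<Rightarrow> (nat \<Rightarrow> 'a) \<Rightarrow> (nat \<Rightarrow> real) \<Rightarrow> ('a \<Rightarrow> complex) \<Rightarrow> 'a \<Rightarrow> complex" where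
  "weighted_lsq \<phi> m xs s f =
     arg_min (\<lambda>v. \<Sum>i<m. s i * (cmod (f (xs i) - v (xs i)))\<^sup>2) (\<lambda>v. v \<in> range (lin_comb \<phi>))"


section \<open>The sampling algorithm\<close>

definition outer :: "complex ^ 'n \<Rightarrow> complex ^ 'n ^ 'n" where
  "outer u = (\<chi> j k. u $ j * cnj (u $ k))"

definition quad_form :: "complex ^ 'n ^ 'n \<Rightarrow> complex ^ 'n \<Rightarrow> complex" where
  "quad_form W u = (\<Sum>j\<in>UNIV. cnj (u $ j) * (W *v u) $ j)"

primrec barrier :: "nat \<Rightarrow> real \<Rightarrow> nat \<Rightarrow> real" where
  "barrier n \<delta> 0 = - real n"
| "barrier n \<delta> (Suc i) = barrier n \<delta> i + \<delta>"

text \<open>In the following, \<open>A\<close> is the matrix $A_i$ after \<open>i\<close> draws, and \<open>W_mat \<delta> i A\<close>,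
  \<open>w_fun \<phi> \<delta> i A\<close>, \<open>R_fun \<phi> \<delta> \<kappa> i A\<close> are $W_{i+1}$, $w_{i+1}$, $R_{i+1}$. As $W_{i+1}$ is
  Hermitian, $w_{i+1}$ is real; the real part only serves to change the type.\<close>

definition W_mat :: "real \<Rightarrow> nat \<Rightarrow> complex ^ 'n ^ 'n \<Rightarrow> complex ^ 'n ^ 'n" where
  "W_mat \<delta> i A =
     (let Y = matrix_inv (A - mat (of_real (barrier CARD('n) \<delta> i)));
          Z = matrix_inv (A - mat (of_real (barrier CARD('n) \<delta> (Suc i))))
      in (\<chi> j k. inverse (trace Z - trace Y) * (Z ** Z) $ j $ k - Z $ j $ k))"

definition w_fun :: "('a \<Rightarrow> complex ^ 'n) \<Rightarrow> real \<Rightarrow> nat \<Rightarrow> complex ^ 'n ^ 'n \<Rightarrow> 'a \<Rightarrow> real" where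
  "w_fun \<phi> \<delta> i A x = Re (quad_form (W_mat \<delta> i A) (\<phi> x))"

definition R_fun ::
  "('a \<Rightarrow> complex ^ 'n) \<Rightarrow> real \<Rightarrow> real \<Rightarrow> nat \<Rightarrow> complex ^ 'n ^ 'n \<Rightarrow> 'a \<Rightarrow> real" where
  "R_fun \<phi> \<delta> \<kappa> i A x =
     (if w_fun \<phi> \<delta> i A x \<ge> \<kappa> * ((1 - \<delta>) / \<delta>) then w_fun \<phi> \<delta> i A x else 0)"

text \<open>The matrices and the weights are functions of the points drawn so far.\<close>

primrec A_mat ::
  "('a \<Rightarrow> complex ^ 'n) \<Rightarrow> real \<Rightarrow> real \<Rightarrow> (nat \<Rightarrow> 'a) \<Rightarrow> nat \<Rightarrow> complex ^ 'n ^ 'n" where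
  "A_mat \<phi> \<delta> \<kappa> xs 0 = 0"
| "A_mat \<phi> \<delta> \<kappa> xs (Suc i) =
     A_mat \<phi> \<delta> \<kappa> xs i
       + (1 / R_fun \<phi> \<delta> \<kappa> i (A_mat \<phi> \<delta> \<kappa> xs i) (xs i)) *\<^sub>R outer (\<phi> (xs i))"

definition weight ::
  "('a \<Rightarrow> complex ^ 'n) \<Rightarrow> real \<Rightarrow> real \<Rightarrow> (nat \<Rightarrow> 'a) \<Rightarrow> nat \<Rightarrow> real" where
  "weight \<phi> \<delta> \<kappa> xs i = 1 / R_fun \<phi> \<delta> \<kappa> i (A_mat \<phi> \<delta> \<kappa> xs i) (xs i)"

text \<open>The distribution of the next point, given the previous ones: density $R_{i+1}/\Gamma_{i+1}$
  with respect to \<open>M\<close>.\<close>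

definition next_point ::
  "'a measure \<Rightarrow> ('a \<Rightarrow> complex ^ 'n) \<Rightarrow> real \<Rightarrow> real \<Rightarrow> (nat \<Rightarrow> 'a) \<Rightarrow> nat \<Rightarrow> 'a measure" where
  "next_point M \<phi> \<delta> \<kappa> xs i =
     (let R = (\<lambda>x. ennreal (R_fun \<phi> \<delta> \<kappa> i (A_mat \<phi> \<delta> \<kappa> xs i) x));
          \<Gamma> = (\<integral>\<^sup>+ x. R x \<partial>M)
      in density M (\<lambda>x. R x / \<Gamma>))"

text \<open>The joint distribution of the points number \<open>0, \<dots>, m - 1\<close> drawn by the algorithm.\<close>

primrec sample_law ::
  "'a measure \<Rightarrow> ('a \<Rightarrow> complex ^ 'n) \<Rightarrow> real \<Rightarrow> real \<Rightarrow> nat \<Rightarrow> (nat \<Rightarrow> 'a) measure" where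
  "sample_law M \<phi> \<delta> \<kappa> 0 = return (\<Pi>\<^sub>M j\<in>{..<0}. M) (\<lambda>_. undefined)"
| "sample_law M \<phi> \<delta> \<kappa> (Suc i) =
     bind (sample_law M \<phi> \<delta> \<kappa> i)
       (\<lambda>xs. distr (next_point M \<phi> \<delta> \<kappa> xs i) (\<Pi>\<^sub>M j\<in>{..<Suc i}. M) (\<lambda>x. xs(i := x)))"

definition sample_approx ::
  "('a \<Rightarrow> complex ^ 'n) \<Rightarrow> real \<Rightarrow> real \<Rightarrow> nat \<Rightarrow> ('a \<Rightarrow> complex) \<Rightarrow> (nat \<Rightarrow> 'a) \<Rightarrow> 'a \<Rightarrow> complex" where
  "sample_approx \<phi> \<delta> \<kappa> m f xs = weighted_lsq \<phi> m xs (weight \<phi> \<delta> \<kappa> xs) f"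

end

theory Submission
  imports Defs
begin

text \<open>Write $P = A_i - \ell_i I$. When the drawn point has positive weight, the choice of $s_i$ and the
  Sherman-Morrison formula keep $\operatorname{Tr} P^{-1} = 1$ exactly, starting from
  $P = n I$. Hence $P^{-1} \le I$, so $A_n \ge (\ell_n + 1) I = \frac{\delta}{1+\delta} I$ and
  interpolation is stable: $\frac{\delta}{1+\delta} \|h\|^2 \le \sum_i s_i |h(x_i)|^2$ for
  $h \in V_n$. Apply this to $h = \tilde f - v$, which takes the values of $g = f - v$ at the points.
  For $\kappa = 0$ every summand has conditional expectation at most $\|g\|^2 / \Gamma_i$ with
  $\Gamma_i \ge \operatorname{Tr} W_i \ge \frac{1-\delta}{\delta}$, and $g$ is orthogonal to $h$ if $v$
  is the projection of $f$; for $\kappa = 1$ the weights are at most $\frac{\delta}{1-\delta}$.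
  Both give the factor $n \frac{1+\delta}{1-\delta} = n^2 (1+\delta)^2 \le 4 n^2$.\<close>


section \<open>Hermitian forms and positive definite matrices\<close>

text \<open>Origin of W: the trace of (A - l I)^{-1} is the lower barrier potential of spectral
  sparsification. Raising the barrier by \<open>\<delta>\<close> raises it by t = Tr Z - Tr Y;
  adding s times the outer square of u lowers it by s a / (1 + s q), where q and a are the forms of
  Z and Z^2 at u. The two changes cancel exactly when 1/s = a/t - q, and the right side is the form
  of W at u. The barrier after n steps is n (\<delta> - 1) < 0, so lying above it says nothing about
  the matrix: invertibility comes from the further distance 1 that a potential equal to 1 enforces.
  Origin of \<delta>: the final lower bound 1 - n (1 - \<delta>) grows with \<delta>, whereas (1 -
  \<delta>) / \<delta>, which bounds the mass or the drawn values of R from below, shrinks. The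
  prescribed \<delta> maximizes the product of the two. In the almost sure bound the exceptional
  null set depends on the comparison function v, so the infimum over V is reached through a sequence
  of values.\<close>

definition cdot :: "complex ^ 'n \<Rightarrow> complex ^ 'n \<Rightarrow> complex" where
  "cdot u v = (\<Sum>j\<in>UNIV. cnj (u $ j) * v $ j)"

lemma quad_form_eq_cdot: "quad_form W u = cdot u (W *v u)"
  by (simp add: quad_form_def cdot_def)

lemma cdot_add_left: "cdot (u + v) w = cdot u w + cdot v w"
  and cdot_add_right: "cdot u (v + w) = cdot u v + cdot u w"
  and cdot_diff_left: "cdot (u - v) w = cdot u w - cdot v w"
  and cdot_diff_right: "cdot u (v - w) = cdot u v - cdot u w"
  by (simp_all add: cdot_def algebra_simps sum.distrib sum_subtractf)

lemma cdot_scale_left: "cdot (c *s u) w = cnj c * cdot u w"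
  and cdot_scale_right: "cdot u (c *s w) = c * cdot u w"
  and cdot_scaleR_left: "cdot (r *\<^sub>R u) w = r * cdot u w"
  and cdot_scaleR_right: "cdot u (r *\<^sub>R w) = r * cdot u w"
  by (simp_all add: cdot_def sum_distrib_left scaleR_conv_of_real[where 'a = complex] mult_ac)

lemma cdot_zero_left [simp]: "cdot 0 u = 0"
  and cdot_zero_right [simp]: "cdot u 0 = 0"
  by (simp_all add: cdot_def)

lemmas cdot_simps = cdot_add_left cdot_add_right cdot_diff_left cdot_diff_right
  cdot_scale_left cdot_scale_right cdot_scaleR_left cdot_scaleR_right

lemma cnj_cdot: "cnj (cdot u v) = cdot v u"
  by (simp add: cdot_def mult.commute)

lemma norm_vec_power2: "(norm u)\<^sup>2 = (\<Sum>j\<in>UNIV. (cmod (u $ j))\<^sup>2)" for u :: "complex ^ 'n"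
  by (simp add: norm_vec_def L2_set_def sum_nonneg)

lemma cdot_self: "cdot u u = of_real ((norm u)\<^sup>2)"
  unfolding cdot_def norm_vec_power2 of_real_sum
  by (intro sum.cong refl) (metis complex_norm_square mult.commute)

lemma mat_of_real: "(mat (of_real r) :: complex ^ 'n ^ 'n) = r *\<^sub>R mat 1"
  by (simp add: mat_def vec_eq_iff scaleR_conv_of_real[where 'a = complex])

lemma matrix_vector_scaleR_left: "(r *\<^sub>R A) *v u = r *\<^sub>R (A *v u)"
  for A :: "complex ^ 'n ^ 'm"
  by (simp add: matrix_vector_mult_def vec_eq_iff scaleR_sum_right)

lemma matrix_vector_scaleR_right: "A *v (r *\<^sub>R u) = r *\<^sub>R (A *v u)"
  for A :: "complex ^ 'n ^ 'm"
  by (simp add: matrix_vector_mult_def vec_eq_iff scaleR_sum_right)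

lemma matrix_mult_scaleR: "(r *\<^sub>R A) ** B = r *\<^sub>R (A ** B)" "A ** (r *\<^sub>R B) = r *\<^sub>R (A ** B)"
  for A :: "complex ^ 'n ^ 'm"
  by (simp_all add: matrix_scalar_ac scalar_matrix_assoc)

lemma matrix_diff_ldistrib: "A ** (B - C) = A ** B - A ** C"
  and matrix_diff_rdistrib: "(B - C) ** D = B ** D - C ** D"
  for A :: "complex ^ 'n ^ 'm" and D :: "complex ^ 'n ^ 'm"
  by (simp_all add: matrix_matrix_mult_def vec_eq_iff algebra_simps sum_subtractf)

lemma matrix_add_rdistrib_complex: "(B + C) ** D = B ** D + C ** D"
  for D :: "complex ^ 'n ^ 'm"
  by (simp add: matrix_matrix_mult_def vec_eq_iff algebra_simps sum.distrib)

lemma trace_scaleR: "trace (r *\<^sub>R A) = of_real r * trace A" for A :: "complex ^ 'n ^ 'n"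
  by (simp add: trace_def sum_distrib_left scaleR_conv_of_real[where 'a = complex])

lemma outer_mult_vec: "outer u *v x = cdot u x *s u"
  by (simp add: outer_def matrix_vector_mult_def vec_eq_iff cdot_def sum_distrib_right sum_distrib_left mult_ac)

lemma trace_mult_outer: "trace (B ** outer u) = cdot u (B *v u)"
proof -
  have "trace (B ** outer u) = (\<Sum>i\<in>UNIV. \<Sum>k\<in>UNIV. B $ i $ k * (u $ k * cnj (u $ i)))"
    by (simp add: trace_def matrix_matrix_mult_def outer_def)
  also have "\<dots> = cdot u (B *v u)"
    by (simp add: cdot_def matrix_vector_mult_def sum_distrib_left mult_ac)
  finally show ?thesis .
qed

lemma trace_eq_cdot: "trace A = (\<Sum>j\<in>UNIV. cdot (axis j 1) (A *v axis j 1))"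
proof -
  have "cdot (axis j 1) (A *v axis j 1) = A $ j $ j" for j
    by (simp add: cdot_def matrix_vector_mult_def axis_def if_distrib if_distribR cong: if_cong)
  thus ?thesis by (simp add: trace_def)
qed

section \<open>Positive definite matrices, their inverses and trace inequalities\<close>

definition hermitian :: "complex ^ 'n ^ 'n \<Rightarrow> bool" where
  "hermitian A \<longleftrightarrow> (\<forall>u v. cdot u (A *v v) = cdot (A *v u) v)"

definition posdef :: "complex ^ 'n ^ 'n \<Rightarrow> bool" where
  "posdef A \<longleftrightarrow> hermitian A \<and> (\<forall>u. u \<noteq> 0 \<longrightarrow> 0 < Re (cdot u (A *v u)))"

lemma hermitianD: "hermitian A \<Longrightarrow> cdot u (A *v v) = cdot (A *v u) v"
  by (simp add: hermitian_def)

lemma hermitian_scaleR: "hermitian A \<Longrightarrow> hermitian (r *\<^sub>R A)"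
  by (simp add: hermitian_def matrix_vector_scaleR_left cdot_simps)

lemma hermitian_add: "hermitian A \<Longrightarrow> hermitian B \<Longrightarrow> hermitian (A + B)"
  by (simp add: hermitian_def matrix_vector_mult_add_rdistrib cdot_simps)

lemma hermitian_diff: "hermitian A \<Longrightarrow> hermitian B \<Longrightarrow> hermitian (A - B)"
  by (simp add: hermitian_def matrix_vector_mult_diff_rdistrib cdot_simps)

lemma hermitian_one: "hermitian (mat 1)"
  by (simp add: hermitian_def)

lemma hermitian_outer: "hermitian (outer u)"
  by (simp add: hermitian_def outer_mult_vec cdot_simps cnj_cdot)

lemma hermitian_quad_real: "hermitian A \<Longrightarrow> cdot u (A *v u) = of_real (Re (cdot u (A *v u)))"
  by (metis cnj_cdot hermitianD complex_is_Real_iff Reals_cnj_iff of_real_Re)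

lemma hermitian_trace_real:
  assumes "hermitian A" shows "trace A = of_real (Re (trace A))"
  unfolding trace_eq_cdot Re_sum of_real_sum
  using hermitian_quad_real[OF assms] by (intro sum.cong refl) blast

lemma posdef_hermitian: "posdef A \<Longrightarrow> hermitian A"
  by (simp add: posdef_def)

lemma posdef_nonneg: "posdef A \<Longrightarrow> 0 \<le> Re (cdot u (A *v u))"
  by (cases "u = 0") (auto simp: posdef_def less_imp_le)

lemma posdef_invertible:
  fixes A :: "complex ^ 'n ^ 'n"
  assumes "posdef A" shows "invertible A"
proof -
  have "u = 0" if "A *v u = 0" for u
  proof (rule ccontr)
    assume "u \<noteq> 0"
    with assms have "0 < Re (cdot u (A *v u))" by (simp add: posdef_def)
    with that show False by simp
  qed
  thus ?thesis unfolding invertible_left_inverse matrix_left_invertible_ker by blast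
qed

lemma matrix_inv_inverse:
  assumes "invertible A"
  shows "A ** matrix_inv A = mat 1" "matrix_inv A ** A = mat 1"
  using someI_ex[OF assms[unfolded invertible_def]] unfolding matrix_inv_def by auto

lemma matrix_inv_unique:
  fixes A :: "complex ^ 'n ^ 'n"
  assumes "A ** B = mat 1" shows "matrix_inv A = B"
proof -
  have "invertible A" using assms invertible_right_inverse by blast
  hence "matrix_inv A ** (A ** B) = B"
    by (simp add: matrix_mul_assoc matrix_inv_inverse)
  thus ?thesis using assms by simp
qed

lemma posdef_matrix_inv:
  fixes A :: "complex ^ 'n ^ 'n"
  assumes "posdef A" shows "posdef (matrix_inv A)"
proof -
  let ?Y = "matrix_inv A"
  have AY: "A *v (?Y *v u) = u" for u
    by (simp add: matrix_vector_mul_assoc matrix_inv_inverse[OF posdef_invertible[OF assms]])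
  have h: "cdot u (?Y *v v) = cdot (?Y *v u) v" for u v
  proof -
    have "cdot u (?Y *v v) = cdot (A *v (?Y *v u)) (?Y *v v)" by (simp add: AY)
    also have "\<dots> = cdot (?Y *v u) (A *v (?Y *v v))"
      using hermitianD[OF posdef_hermitian[OF assms]] by simp
    finally show ?thesis by (simp add: AY)
  qed
  have "0 < Re (cdot u (?Y *v u))" if "u \<noteq> 0" for u
  proof -
    have "?Y *v u \<noteq> 0" using AY[of u] that by auto
    hence "0 < Re (cdot (?Y *v u) (A *v (?Y *v u)))" using assms by (simp add: posdef_def)
    thus ?thesis by (simp add: AY h)
  qed
  thus ?thesis using h by (simp add: posdef_def hermitian_def)
qed

text \<open>A substitute for eigenvalues: the less obvious trace inequalities below arise from a
  choice of Q. It is \<open>r *\<^sub>R mat 1 - outer u\<close> for bounding a form by the trace, Y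
  itself for the positivity of Tr(YZ), and a shift of Z for the lower bound on Tr W.\<close>

lemma trace_congruence_nonneg:
  assumes "posdef Y" "hermitian Q"
  shows "0 \<le> Re (trace (Q ** Y ** Q))"
proof -
  have "cdot u ((Q ** Y ** Q) *v u) = cdot (Q *v u) (Y *v (Q *v u))" for u
    using hermitianD[OF assms(2)] by (simp add: matrix_vector_mul_assoc[symmetric])
  thus ?thesis using posdef_nonneg[OF assms(1)]
    by (simp add: trace_eq_cdot sum_nonneg)
qed

lemma trace_posdef_pos:
  assumes "posdef B" shows "0 < Re (trace B)"
  unfolding trace_eq_cdot Re_sum
  using assms by (intro sum_pos) (auto simp: posdef_def axis_eq_0_iff)

lemma trace_square_pos:
  assumes "posdef B" shows "0 < Re (trace (B ** B))"
proof (rule trace_posdef_pos)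
  have h: "cdot u ((B ** B) *v v) = cdot (B *v u) (B *v v)" for u v
    using hermitianD[OF posdef_hermitian[OF assms], of u "B *v v"]
    by (simp add: matrix_vector_mul_assoc)
  have h': "cdot ((B ** B) *v u) v = cdot (B *v u) (B *v v)" for u v
    by (metis h cnj_cdot)
  have "B *v u \<noteq> 0" if "u \<noteq> 0" for u
    using that assms by (auto simp: posdef_def)
  thus "posdef (B ** B)" by (simp add: posdef_def hermitian_def h h' cdot_self)
qed

text \<open>Apply \<open>trace_congruence_nonneg\<close> to $Q = |u|^2 I - u u^*$, for which $Q^2 = |u|^2 Q$.\<close>

lemma posdef_quad_le_trace:
  fixes Y :: "complex ^ 'n ^ 'n"
  assumes "posdef Y"
  shows "Re (cdot u (Y *v u)) \<le> Re (trace Y) * (norm u)\<^sup>2"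
proof (cases "u = 0")
  case False
  define r where "r = (norm u)\<^sup>2"
  have r: "r > 0" using False by (simp add: r_def)
  define Q where "Q = r *\<^sub>R mat 1 - outer u"
  have hQ: "hermitian Q"
    unfolding Q_def by (intro hermitian_diff hermitian_scaleR hermitian_one hermitian_outer)
  have QQ: "Q ** Q = r *\<^sub>R Q"
    unfolding matrix_eq
    by (simp add: matrix_vector_mul_assoc[symmetric] Q_def matrix_vector_mult_diff_rdistrib
        matrix_vector_scaleR_left matrix_vector_scaleR_right outer_mult_vec cdot_simps cdot_self r_def[symmetric] algebra_simps
        vec_eq_iff scaleR_conv_of_real[where 'a = complex])
  have "trace (Q ** Y ** Q) = r * trace (Y ** Q)"
    using trace_mul_sym[of "Q ** Y" Q] trace_mul_sym[of Y Q]
    by (simp add: matrix_mul_assoc QQ matrix_mult_scaleR trace_scaleR)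
  also have "\<dots> = r * (r * trace Y - cdot u (Y *v u))"
    by (simp add: Q_def matrix_diff_ldistrib matrix_mult_scaleR trace_sub trace_scaleR trace_mult_outer)
  finally have "0 \<le> r * (r * Re (trace Y) - Re (cdot u (Y *v u)))"
    using trace_congruence_nonneg[OF assms hQ] by simp
  thus ?thesis using r by (simp add: zero_le_mult_iff r_def mult.commute)
qed simp

text \<open>The form of P at u - Y u, with Y the inverse, is nonnegative and expands to the form of
  P at u, minus 2 |u|^2, plus the form of Y at u. The last term is at most Tr Y |u|^2, hence at most
  |u|^2.\<close>

lemma posdef_ge_norm:
  fixes P :: "complex ^ 'n ^ 'n"
  assumes P: "posdef P" and tr: "Re (trace (matrix_inv P)) \<le> 1"
  shows "(norm u)\<^sup>2 \<le> Re (cdot u (P *v u))"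
proof -
  let ?Y = "matrix_inv P"
  have PY: "P *v (?Y *v u) = u"
    by (simp add: matrix_vector_mul_assoc matrix_inv_inverse[OF posdef_invertible[OF P]])
  have hY: "hermitian ?Y" using posdef_matrix_inv[OF P] by (rule posdef_hermitian)
  have "0 \<le> Re (cdot (u - ?Y *v u) (P *v (u - ?Y *v u)))"
    by (rule posdef_nonneg[OF P])
  also have "cdot (u - ?Y *v u) (P *v (u - ?Y *v u))
      = cdot u (P *v u) - 2 * of_real ((norm u)\<^sup>2) + cdot u (?Y *v u)"
    using hermitianD[OF posdef_hermitian[OF P], of "?Y *v u" u] hermitianD[OF hY, of u u]
    by (simp add: matrix_vector_mult_diff_distrib cdot_simps PY cdot_self)
  finally have "0 \<le> Re (cdot u (P *v u)) - 2 * (norm u)\<^sup>2 + Re (cdot u (?Y *v u))" by simp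
  moreover have "Re (cdot u (?Y *v u)) \<le> 1 * (norm u)\<^sup>2"
    using posdef_quad_le_trace[OF posdef_matrix_inv[OF P], of u]
      mult_right_mono[OF tr zero_le_power2[of "norm u"]] by linarith
  ultimately show ?thesis by simp
qed

section \<open>One step of the barrier method\<close>

text \<open>The trace is the barrier potential, which blows up when an eigenvalue of A approaches l
  from above. It is fixed by an equality because each step restores it exactly.\<close>

definition barrier_inv :: "real \<Rightarrow> complex ^ 'n ^ 'n \<Rightarrow> bool" where
  "barrier_inv l A \<longleftrightarrow> posdef (A - l *\<^sub>R mat 1) \<and> trace (matrix_inv (A - l *\<^sub>R mat 1)) = 1"

text \<open>The summand 1 is the gain from the potential. It carries the whole argument, since l
  stays negative during the n steps.\<close>

lemma barrier_inv_quad_ge: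
  assumes "barrier_inv l A"
  shows "(l + 1) * (norm u)\<^sup>2 \<le> Re (cdot u (A *v u))"
  using posdef_ge_norm[of "A - l *\<^sub>R mat 1" u] assms
  by (simp add: barrier_inv_def matrix_vector_mult_diff_rdistrib matrix_vector_scaleR_left
      cdot_simps cdot_self algebra_simps)

lemma posdef_one: "posdef (mat 1)"
  by (simp add: posdef_def hermitian_one cdot_self)

lemma posdef_scaleR: "posdef A \<Longrightarrow> r > 0 \<Longrightarrow> posdef (r *\<^sub>R A)"
  by (simp add: posdef_def hermitian_scaleR matrix_vector_scaleR_left cdot_simps)

lemma barrier_inv_zero: "barrier_inv (- real CARD('n)) (0 :: complex ^ 'n ^ 'n)"
proof -
  have eq: "(0 :: complex ^ 'n ^ 'n) - (- real CARD('n)) *\<^sub>R mat 1 = real CARD('n) *\<^sub>R mat 1"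
    by simp
  have "matrix_inv (real CARD('n) *\<^sub>R mat 1 :: complex ^ 'n ^ 'n) = (1 / real CARD('n)) *\<^sub>R mat 1"
    by (rule matrix_inv_unique) (simp add: matrix_mult_scaleR)
  thus ?thesis
    unfolding barrier_inv_def eq
    by (auto intro: posdef_scaleR posdef_one simp: trace_scaleR trace_I)
qed

locale barrier_step =
  fixes \<delta> :: real and i :: nat and A :: "complex ^ 'n ^ 'n"
  assumes \<delta>: "0 < \<delta>" "\<delta> < 1"
    and inv: "barrier_inv (barrier CARD('n) \<delta> i) A"
begin

definition P where "P = A - barrier CARD('n) \<delta> i *\<^sub>R mat 1"
definition P' where "P' = A - barrier CARD('n) \<delta> (Suc i) *\<^sub>R mat 1"
definition Y where "Y = matrix_inv P"
definition Z where "Z = matrix_inv P'"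
text \<open>The increase of the potential caused by moving the barrier, which the next rank one
  update has to undo.\<close>

definition t where "t = Re (trace Z) - Re (trace Y)"

lemma posdef_P: "posdef P" and trace_Y: "trace Y = 1"
  using inv by (simp_all add: barrier_inv_def P_def Y_def)

lemma P'_eq: "P' = P - \<delta> *\<^sub>R mat 1"
  by (simp add: P_def P'_def algebra_simps)

text \<open>P dominates the identity because its inverse has trace 1, so subtracting \<delta> < 1
  times the identity leaves a positive definite matrix: the barrier can always be moved.\<close>

lemma posdef_P': "posdef P'"
proof -
  have "0 < Re (cdot u (P' *v u))" if "u \<noteq> 0" for u
  proof -
    have "(norm u)\<^sup>2 \<le> Re (cdot u (P *v u))"
      using posdef_ge_norm[OF posdef_P] trace_Y by (simp add: Y_def)
    moreover have "\<delta> * (norm u)\<^sup>2 < 1 * (norm u)\<^sup>2" using \<delta> that by (intro mult_strict_right_mono) auto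
    ultimately show ?thesis
      by (simp add: P'_eq matrix_vector_mult_diff_rdistrib matrix_vector_scaleR_left cdot_simps cdot_self)
  qed
  thus ?thesis
    using hermitian_diff[OF posdef_hermitian[OF posdef_P] hermitian_scaleR[OF hermitian_one, of \<delta>]]
    by (simp add: posdef_def P'_eq)
qed

lemma inverses: "P ** Y = mat 1" "Y ** P = mat 1" "P' ** Z = mat 1" "Z ** P' = mat 1"
  using matrix_inv_inverse[OF posdef_invertible[OF posdef_P]]
    matrix_inv_inverse[OF posdef_invertible[OF posdef_P']]
  by (simp_all add: Y_def Z_def)

lemma posdef_Y: "posdef Y" and posdef_Z: "posdef Z"
  by (simp_all add: Y_def Z_def posdef_matrix_inv posdef_P posdef_P')

lemma hermitian_Z: "hermitian Z" and hermitian_Y: "hermitian Y"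
  using posdef_Y posdef_Z by (simp_all add: posdef_hermitian)

text \<open>Multiply P - P' = \<delta> I by the two inverses, one on each side, in both orders.
  Comparing the results shows that Y and Z commute.\<close>

lemma resolvent: "Z - Y = \<delta> *\<^sub>R (Y ** Z)" "Z - Y = \<delta> *\<^sub>R (Z ** Y)"
proof -
  have "Y ** (P - P') ** Z = Z - Y"
    using inverses
    by (simp add: matrix_diff_ldistrib matrix_diff_rdistrib) (simp add: matrix_mul_assoc[symmetric])
  thus "Z - Y = \<delta> *\<^sub>R (Y ** Z)"
    by (simp add: P'_eq matrix_mult_scaleR)
  have "Z ** (P - P') ** Y = Z - Y"
    using inverses
    by (simp add: matrix_diff_ldistrib matrix_diff_rdistrib) (simp add: matrix_mul_assoc[symmetric])
  thus "Z - Y = \<delta> *\<^sub>R (Z ** Y)"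
    by (simp add: P'_eq matrix_mult_scaleR)
qed

lemma YZ_commute: "Y ** Z = Z ** Y"
  using resolvent \<delta> by simp

lemma t_eq: "t = \<delta> * Re (trace (Y ** Z))"
  using arg_cong[OF resolvent(1), of "\<lambda>A. Re (trace A)"] by (simp add: trace_sub trace_scaleR t_def)

lemma Z_eq: "Z = Y + \<delta> *\<^sub>R (Y ** Z)"
  using resolvent(1) by (metis add.commute diff_add_cancel)

text \<open>Inserting Z = Y + \<delta> Y Z once, and commuting, gives Tr(YZ) = Tr(Y^2) + \<delta>
  Tr(Y Z Y), a positive plus a nonnegative term. Hence t > 0 and the division by t in W is
  legitimate.\<close>

lemma trace_YZ_pos: "0 < Re (trace (Y ** Z))"
proof -
  have "Y ** Z = Y ** Y + \<delta> *\<^sub>R (Y ** Z ** Y)"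
    by (subst Z_eq) (simp add: matrix_add_ldistrib matrix_mult_scaleR YZ_commute matrix_mul_assoc)
  hence "Re (trace (Y ** Z)) = Re (trace (Y ** Y)) + \<delta> * Re (trace (Y ** Z ** Y))"
    using trace_add[of "Y ** Y" "\<delta> *\<^sub>R (Y ** Z ** Y)"] by (simp add: trace_scaleR)
  moreover have "0 \<le> Re (trace (Y ** Z ** Y))"
    by (rule trace_congruence_nonneg[OF posdef_Z hermitian_Y])
  ultimately show ?thesis using trace_square_pos[OF posdef_Y] \<delta>
    by (simp add: add_pos_nonneg)
qed

lemma t_pos: "0 < t" using \<delta> trace_YZ_pos by (simp add: t_eq)

lemma W_mat_eq: "W_mat \<delta> i A = (1 / t) *\<^sub>R (Z ** Z) - Z"
proof -
  have "trace Z - trace Y = of_real t"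
    using hermitian_trace_real[OF hermitian_Z] hermitian_trace_real[OF hermitian_Y]
    by (simp add: t_def)
  thus ?thesis
    unfolding W_mat_def mat_of_real P_def[symmetric] P'_def[symmetric] Y_def[symmetric] Z_def[symmetric] Let_def
    by (simp add: vec_eq_iff scaleR_conv_of_real[where 'a = complex] divide_inverse)
qed

text \<open>Since $\operatorname{Tr} Y = 1$, expanding
  $0 \le \operatorname{Tr}((\tau - Z) Y (\tau - Z))$ at $\tau = \operatorname{Tr}(YZ)$ gives
  $\tau^2 \le \operatorname{Tr}(ZYZ)$.\<close>

lemma trace_W_ge: "(1 - \<delta>) / \<delta> \<le> Re (trace (W_mat \<delta> i A))"
proof -
  define \<tau> where "\<tau> = Re (trace (Y ** Z))"
  define \<sigma> where "\<sigma> = Re (trace (Z ** Y ** Z))"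
  have \<tau>: "\<tau> > 0" using trace_YZ_pos by (simp add: \<tau>_def)
  have "0 \<le> Re (trace ((\<tau> *\<^sub>R mat 1 - Z) ** Y ** (\<tau> *\<^sub>R mat 1 - Z)))"
    by (intro trace_congruence_nonneg posdef_Y hermitian_diff hermitian_Z hermitian_scaleR hermitian_one)
  also have "\<dots> = \<sigma> - \<tau>\<^sup>2"
    by (simp add: matrix_diff_ldistrib matrix_diff_rdistrib matrix_mult_scaleR
        trace_sub trace_scaleR trace_Y YZ_commute[symmetric] \<tau>_def \<sigma>_def power2_eq_square)
  finally have le: "\<tau>\<^sup>2 \<le> \<sigma>" by simp
  have "Z ** Z = Z ** (Y + \<delta> *\<^sub>R (Y ** Z))" using Z_eq by simp
  hence ZZ: "Re (trace (Z ** Z)) = \<tau> + \<delta> * \<sigma>"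
    by (simp add: matrix_add_ldistrib matrix_mult_scaleR YZ_commute[symmetric] trace_add trace_scaleR
        \<tau>_def \<sigma>_def matrix_mul_assoc)
  have Zt: "Re (trace Z) = 1 + \<delta> * \<tau>"
    using t_eq by (simp add: t_def trace_Y \<tau>_def)
  \<comment> \<open>By \<open>ZZ\<close>, \<open>Zt\<close> and \<open>t_eq\<close>, Tr W equals
    1/\<delta> - 1 + \<sigma>/\<tau> - \<delta> \<tau>. The last two terms have nonnegative sum
    because \<sigma>/\<tau> \<ge> \<tau> \<ge> \<delta> \<tau>.\<close>
  have "(1 - \<delta>) / \<delta> = 1 / \<delta> - 1" using \<delta> by (simp add: field_simps)
  moreover have "(\<tau> + \<delta> * \<sigma>) / (\<delta> * \<tau>) = 1 / \<delta> + \<sigma> / \<tau>" using \<delta> \<tau> by (simp add: field_simps)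
  moreover have "\<tau> \<le> \<sigma> / \<tau>" using le \<tau> by (simp add: field_simps power2_eq_square)
  moreover have "\<delta> * \<tau> \<le> 1 * \<tau>" using \<delta> \<tau> by (intro mult_right_mono) auto
  ultimately show ?thesis
    by (simp add: W_mat_eq trace_sub trace_scaleR ZZ Zt t_eq flip: \<tau>_def)
qed

definition wt where "wt u = Re (quad_form (W_mat \<delta> i A) u)"

text \<open>The weight is chosen so that, by the Sherman-Morrison formula, the rank one update decreases
  the trace of the inverse by exactly $\operatorname{Tr} Z - \operatorname{Tr} Y$.\<close>

lemma barrier_inv_step:
  assumes w: "wt u > 0"
  shows "barrier_inv (barrier CARD('n) \<delta> (Suc i)) (A + (1 / wt u) *\<^sub>R outer u)"
proof -
  define s where "s = 1 / wt u"
  have s: "s > 0" using w by (simp add: s_def)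
  define q where "q = Re (cdot u (Z *v u))"
  define a where "a = Re (cdot u (Z *v (Z *v u)))"
  have q: "q \<ge> 0" by (simp add: q_def posdef_nonneg posdef_Z)
  have qc: "cdot u (Z *v u) = of_real q" using hermitian_quad_real[OF hermitian_Z] by (simp add: q_def)
  have wt: "wt u = a / t - q"
    by (simp add: wt_def W_mat_eq quad_form_eq_cdot matrix_vector_mult_diff_rdistrib
        matrix_vector_scaleR_left cdot_simps matrix_vector_mul_assoc[symmetric] a_def q_def)
  have ac: "cdot u (Z *v (Z *v u)) = of_real a"
    by (simp add: a_def hermitianD[OF hermitian_Z] cdot_self)
  define N where "N = A + s *\<^sub>R outer u - barrier CARD('n) \<delta> (Suc i) *\<^sub>R mat 1"
  have N: "N = P' + s *\<^sub>R outer u" by (simp add: N_def P'_def)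
  have "posdef N"
    unfolding posdef_def
  proof (intro conjI allI impI)
    show "hermitian N" unfolding N
      by (intro hermitian_add hermitian_scaleR hermitian_outer posdef_hermitian posdef_P')
    fix v :: "complex ^ 'n" assume "v \<noteq> 0"
    hence "0 < Re (cdot v (P' *v v))" using posdef_P' by (simp add: posdef_def)
    moreover have "0 \<le> Re (of_real s * (cdot u v * cdot v u))"
    proof -
      have "cdot u v * cdot v u = of_real ((cmod (cdot u v))\<^sup>2)"
        by (metis cnj_cdot complex_norm_square)
      thus ?thesis using s by simp
    qed
    ultimately show "0 < Re (cdot v (N *v v))"
      by (simp add: N matrix_vector_mult_add_rdistrib matrix_vector_scaleR_left outer_mult_vec cdot_simps
          add_pos_nonneg del: times_complex.simps)
  qed
  \<comment> \<open>The Sherman-Morrison coefficient: the inverse of N is Z - c Z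
    \<open>outer u\<close> Z. In the product with N the multiples of K = \<open>outer u\<close> Z
    add up to s - c - s c q, which vanishes for this c.\<close>
  define c where "c = s / (1 + s * q)"
  have pos: "1 + s * q > 0" using s q by (simp add: add_pos_nonneg)
  have c: "s - c - s * c * q = 0" using pos by (simp add: c_def field_simps)
  have ooo: "outer u ** Z ** outer u = q *\<^sub>R outer u"
    unfolding matrix_eq
    by (simp add: matrix_vector_mul_assoc[symmetric] outer_mult_vec cdot_simps vector_scalar_commute qc
        matrix_vector_scaleR_left vec_eq_iff scaleR_conv_of_real[where 'a = complex])
  define K where "K = outer u ** Z"
  have "P' ** (Z ** K) = K" "P' ** Z = mat 1" by (simp_all add: inverses matrix_mul_assoc)
  moreover have "outer u ** (Z ** K) = q *\<^sub>R K"
    unfolding K_def using ooo by (simp add: matrix_mul_assoc matrix_mult_scaleR)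
  ultimately have "N ** (Z - c *\<^sub>R (Z ** K)) = mat 1 - c *\<^sub>R K + s *\<^sub>R (K - (c * q) *\<^sub>R K)"
    by (simp add: N matrix_add_rdistrib_complex matrix_diff_ldistrib matrix_mult_scaleR K_def[symmetric] algebra_simps)
  also have "\<dots> = mat 1 + (s - c - s * c * q) *\<^sub>R K" by (simp add: algebra_simps)
  finally have "matrix_inv N = Z - c *\<^sub>R (Z ** K)"
    using c by (intro matrix_inv_unique) simp
  moreover have "trace (Z ** K) = of_real a"
    using trace_mul_sym[of "Z ** outer u" Z]
    by (simp add: K_def matrix_mul_assoc trace_mult_outer ac matrix_vector_mul_assoc[symmetric])
  ultimately have tr: "trace (matrix_inv N) = trace Z - of_real (c * a)"
    by (simp add: trace_sub trace_scaleR)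
  \<comment> \<open>The trace drops by c a. With s = 1 / \<open>wt u\<close> the coefficient c
    becomes 1 / (\<open>wt u\<close> + q), and \<open>wt u\<close> + q = a / t by the form of W, so
    the drop is t.\<close>
  have "c = 1 / (wt u + q)" using w pos by (simp add: c_def s_def field_simps)
  hence "c * a = a / (a / t)" by (simp add: wt)
  moreover have "a / t > 0" using wt w q by linarith
  ultimately have "c * a = t" using t_pos by auto
  hence "trace (matrix_inv N) = trace Y"
    using tr hermitian_trace_real[OF hermitian_Z] hermitian_trace_real[OF hermitian_Y]
    by (simp add: t_def)
  thus ?thesis
    using \<open>posdef N\<close> trace_Y by (simp add: barrier_inv_def N_def s_def)
qed

end

section \<open>Stability of interpolation\<close>

lemma A_mat_cong: "(\<And>j. j < i \<Longrightarrow> xs j = ys j) \<Longrightarrow> A_mat \<phi> \<delta> \<kappa> xs i = A_mat \<phi> \<delta> \<kappa> ys i"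
  by (induction i) auto

lemma barrier_eq: "barrier n \<delta> i = real i * \<delta> - real n"
  by (induction i) (auto simp: algebra_simps)

lemma quad_A_mat:
  "cdot c (A_mat \<phi> \<delta> \<kappa> xs i *v c)
     = of_real (\<Sum>j<i. weight \<phi> \<delta> \<kappa> xs j * (cmod (cdot (\<phi> (xs j)) c))\<^sup>2)"
proof (induction i)
  case (Suc i)
  have "cdot (\<phi> (xs i)) c * cdot c (\<phi> (xs i)) = of_real ((cmod (cdot (\<phi> (xs i)) c))\<^sup>2)"
    by (metis cnj_cdot complex_norm_square)
  thus ?case using Suc
    by (simp add: matrix_vector_mult_add_rdistrib matrix_vector_scaleR_left outer_mult_vec cdot_simps
        weight_def)
qed simp

text \<open>The event on which the deterministic barrier argument runs. Where R is 0 the weight is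
  1/0 = 0 and the update adds nothing; such draws are excluded here and form a null set of the
  sampling law.\<close>

definition positive_draws ::
  "('a \<Rightarrow> complex ^ 'n) \<Rightarrow> real \<Rightarrow> real \<Rightarrow> (nat \<Rightarrow> 'a) \<Rightarrow> nat \<Rightarrow> bool" where
  "positive_draws \<phi> \<delta> \<kappa> xs i \<longleftrightarrow> (\<forall>j<i. 0 < R_fun \<phi> \<delta> \<kappa> j (A_mat \<phi> \<delta> \<kappa> xs j) (xs j))"

lemma barrier_inv_A_mat:
  fixes \<phi> :: "'a \<Rightarrow> complex ^ 'n"
  assumes "0 < \<delta>" "\<delta> < 1" "positive_draws \<phi> \<delta> \<kappa> xs i"
  shows "barrier_inv (barrier CARD('n) \<delta> i) (A_mat \<phi> \<delta> \<kappa> xs i)"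
  using assms(3)
proof (induction i)
  case 0
  show ?case using barrier_inv_zero by simp
next
  case (Suc i)
  hence inv: "barrier_inv (barrier CARD('n) \<delta> i) (A_mat \<phi> \<delta> \<kappa> xs i)"
    by (simp add: positive_draws_def)
  interpret barrier_step \<delta> i "A_mat \<phi> \<delta> \<kappa> xs i"
    using assms inv by unfold_locales auto
  have R: "0 < R_fun \<phi> \<delta> \<kappa> i (A_mat \<phi> \<delta> \<kappa> xs i) (xs i)"
    using Suc.prems by (simp add: positive_draws_def)
  hence "R_fun \<phi> \<delta> \<kappa> i (A_mat \<phi> \<delta> \<kappa> xs i) (xs i) = wt (\<phi> (xs i))"
    by (auto simp: R_fun_def w_fun_def wt_def split: if_splits)
  thus ?case using barrier_inv_step[of "\<phi> (xs i)"] R by simp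
qed

lemma lin_comb_add: "lin_comb \<phi> (c + d) x = lin_comb \<phi> c x + lin_comb \<phi> d x"
  and lin_comb_diff: "lin_comb \<phi> (c - d) x = lin_comb \<phi> c x - lin_comb \<phi> d x"
  by (simp_all add: lin_comb_def algebra_simps sum.distrib sum_subtractf)

text \<open>For an orthonormal basis, \<open>norm c\<close> is the L2 norm of
  \<open>lin_comb \<phi> c\<close> (\<open>integral_lin_comb_power2\<close>), so this compares the
  continuous norm with the sampled one.\<close>

lemma sampling_stability:
  fixes \<phi> :: "'a \<Rightarrow> complex ^ 'n"
  assumes "0 < \<delta>" "\<delta> < 1" "positive_draws \<phi> \<delta> \<kappa> xs i"
  shows "(barrier CARD('n) \<delta> i + 1) * (norm c)\<^sup>2
    \<le> (\<Sum>j<i. weight \<phi> \<delta> \<kappa> xs j * (cmod (lin_comb \<phi> c (xs j)))\<^sup>2)"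
proof -
  \<comment> \<open>\<open>cdot\<close> conjugates the basis values and \<open>lin_comb\<close> does
    not. Conjugating the coefficients turns one into the conjugate of the other and preserves norm
    and modulus.\<close>
  define d :: "complex ^ 'n" where "d = (\<chi> j. cnj (c $ j))"
  have "norm d = norm c" by (simp add: norm_vec_def d_def)
  moreover have "cmod (cdot (\<phi> x) d) = cmod (lin_comb \<phi> c x)" for x
  proof -
    have "cdot (\<phi> x) d = cnj (lin_comb \<phi> c x)"
      by (simp add: cdot_def lin_comb_def d_def mult.commute)
    thus ?thesis by simp
  qed
  ultimately show ?thesis
    using barrier_inv_quad_ge[OF barrier_inv_A_mat[OF assms], of d] by (simp add: quad_A_mat)
qed

text \<open>Evaluation at as many points as there are basis functions is a square linear map, so
  injectivity gives surjectivity. The bijection \<open>e\<close> numbers the index type, making the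
  evaluations the rows of a square matrix.\<close>

lemma interpolation_exists:
  fixes \<phi> :: "'a \<Rightarrow> complex ^ 'n"
  assumes inj: "\<And>c. (\<And>j. j < CARD('n) \<Longrightarrow> lin_comb \<phi> c (xs j) = 0) \<Longrightarrow> c = 0"
  shows "\<exists>c. \<forall>j<CARD('n). lin_comb \<phi> c (xs j) = f (xs j)"
proof -
  obtain e :: "'n \<Rightarrow> nat" where e: "bij_betw e UNIV {..<CARD('n)}"
    by (metis atLeast0LessThan ex_bij_betw_finite_nat finite)
  define B :: "complex ^ 'n ^ 'n" where "B = (\<chi> k. \<phi> (xs (e k)))"
  have B: "(B *v c) $ k = lin_comb \<phi> c (xs (e k))" for c k
    by (simp add: B_def matrix_vector_mult_def lin_comb_def mult.commute)
  have surj: "\<exists>k. j = e k" if "j < CARD('n)" for j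
    using e that unfolding bij_betw_def by (metis imageE lessThan_iff)
  have "c = 0" if "B *v c = 0" for c
  proof (rule inj)
    fix j assume "j < CARD('n)"
    then obtain k where "j = e k" using surj by blast
    thus "lin_comb \<phi> c (xs j) = 0" using B[of c k] that by simp
  qed
  hence "invertible B" unfolding invertible_left_inverse matrix_left_invertible_ker by blast
  hence "B *v (matrix_inv B *v (\<chi> k. f (xs (e k)))) = (\<chi> k. f (xs (e k)))"
    by (simp add: matrix_vector_mul_assoc matrix_inv_inverse)
  hence "lin_comb \<phi> (matrix_inv B *v (\<chi> k. f (xs (e k)))) (xs (e k)) = f (xs (e k))" for k
    using B by (metis vec_lambda_beta)
  thus ?thesis using surj by metis
qed

text \<open>\<open>arg_min\<close> is a choice among minimizers, so the argument covers all of them: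
  stability makes evaluation injective, hence an interpolant exists and the minimal value is 0; as
  the weights are positive, any minimizer then agrees with f at every point.\<close>

lemma sample_approx_interpolates:
  fixes \<phi> :: "'a \<Rightarrow> complex ^ 'n"
  assumes \<delta>: "0 < \<delta>" "\<delta> < 1" and pos: "positive_draws \<phi> \<delta> \<kappa> xs CARD('n)"
    and l: "0 < barrier CARD('n) \<delta> CARD('n) + 1"
  shows "\<exists>c. sample_approx \<phi> \<delta> \<kappa> CARD('n) f xs = lin_comb \<phi> c
           \<and> (\<forall>j<CARD('n). lin_comb \<phi> c (xs j) = f (xs j))"
proof -
  let ?s = "weight \<phi> \<delta> \<kappa> xs"
  define F where "F v = (\<Sum>j<CARD('n). ?s j * (cmod (f (xs j) - v (xs j)))\<^sup>2)" for v
  have s: "?s j > 0" if "j < CARD('n)" for j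
    using pos that by (simp add: weight_def positive_draws_def)
  have "c = 0" if "\<And>j. j < CARD('n) \<Longrightarrow> lin_comb \<phi> c (xs j) = 0" for c
  proof -
    have "(barrier CARD('n) \<delta> CARD('n) + 1) * (norm c)\<^sup>2 \<le> 0"
      using sampling_stability[OF \<delta> pos, of c] that by simp
    thus ?thesis using l by (simp add: mult_le_0_iff)
  qed
  then obtain c0 where "\<And>j. j < CARD('n) \<Longrightarrow> lin_comb \<phi> c0 (xs j) = f (xs j)"
    using interpolation_exists[of \<phi> xs f] by metis
  hence F0: "F (lin_comb \<phi> c0) = 0" by (simp add: F_def)
  have Fnn: "F v \<ge> 0" for v
    unfolding F_def using s by (intro sum_nonneg) (simp add: less_imp_le)
  have "arg_min F (\<lambda>v. v \<in> range (lin_comb \<phi>)) \<in> {v \<in> range (lin_comb \<phi>). F v = 0}"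
  proof (rule arg_minI[where x = "lin_comb \<phi> c0" and f = F])
    show "lin_comb \<phi> c0 \<in> range (lin_comb \<phi>)" by simp
    show "\<not> F y < F (lin_comb \<phi> c0)" for y using Fnn[of y] F0 by simp
    fix v assume "v \<in> range (lin_comb \<phi>)" "\<forall>y. y \<in> range (lin_comb \<phi>) \<longrightarrow> \<not> F y < F v"
    moreover from this(2) have "\<not> F (lin_comb \<phi> c0) < F v" by blast
    ultimately show "v \<in> {v \<in> range (lin_comb \<phi>). F v = 0}"
      using F0 Fnn[of v] by simp
  qed
  moreover have "sample_approx \<phi> \<delta> \<kappa> CARD('n) f xs = arg_min F (\<lambda>v. v \<in> range (lin_comb \<phi>))"
    by (simp add: sample_approx_def weighted_lsq_def F_def[abs_def])
  ultimately obtain c where c: "sample_approx \<phi> \<delta> \<kappa> CARD('n) f xs = lin_comb \<phi> c"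
    and 0: "F (lin_comb \<phi> c) = 0" by auto
  have "\<forall>j\<in>{..<CARD('n)}. ?s j * (cmod (f (xs j) - lin_comb \<phi> c (xs j)))\<^sup>2 = 0"
    using 0 s by (subst (asm) F_def, subst (asm) sum_nonneg_eq_0_iff) (auto simp: less_imp_le)
  hence "\<forall>j<CARD('n). lin_comb \<phi> c (xs j) = f (xs j)" using s by force
  thus ?thesis using c by blast
qed

lemma sample_approx_error:
  fixes \<phi> :: "'a \<Rightarrow> complex ^ 'n"
  assumes "0 < \<delta>" "\<delta> < 1" "positive_draws \<phi> \<delta> \<kappa> xs CARD('n)"
    and "0 < barrier CARD('n) \<delta> CARD('n) + 1"
  shows "\<exists>c. sample_approx \<phi> \<delta> \<kappa> CARD('n) f xs = lin_comb \<phi> (c0 + c)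
     \<and> (barrier CARD('n) \<delta> CARD('n) + 1) * (norm c)\<^sup>2
       \<le> (\<Sum>j<CARD('n). weight \<phi> \<delta> \<kappa> xs j * (cmod (f (xs j) - lin_comb \<phi> c0 (xs j)))\<^sup>2)"
proof -
  obtain c where c: "sample_approx \<phi> \<delta> \<kappa> CARD('n) f xs = lin_comb \<phi> c"
    "\<And>j. j < CARD('n) \<Longrightarrow> lin_comb \<phi> c (xs j) = f (xs j)"
    using sample_approx_interpolates[OF assms] by blast
  show ?thesis
    using c sampling_stability[OF assms(1-3), of "c - c0"]
    by (intro exI[of _ "c - c0"]) (simp add: lin_comb_diff)
qed

section \<open>Measurability of matrix functions\<close>

lemma borel_measurable_vec_nth [measurable (raw)]:
  fixes f :: "'a \<Rightarrow> 'b :: euclidean_space ^ 'n"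
  assumes "f \<in> borel_measurable M" shows "(\<lambda>x. f x $ i) \<in> borel_measurable M"
  by (rule borel_measurable_continuous_on[OF _ assms]) (intro continuous_intros)

lemma borel_measurable_vecI:
  fixes f :: "'a \<Rightarrow> 'b :: euclidean_space ^ 'n"
  assumes "\<And>i. (\<lambda>x. f x $ i) \<in> borel_measurable M" shows "f \<in> borel_measurable M"
proof -
  have eq: "f = (\<lambda>x. \<Sum>i\<in>UNIV. axis i (f x $ i))"
    by (simp add: fun_eq_iff vec_eq_iff axis_def if_distrib cong: if_cong)
  have cont: "continuous_on UNIV (axis i :: 'b \<Rightarrow> 'b ^ 'n)" for i
  proof -
    have "continuous_on UNIV (\<lambda>y :: 'b. if j = i then y else 0)" for j
      by (cases "j = i") auto
    thus ?thesis unfolding axis_def by (intro continuous_on_vec_lambda)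
  qed
  show ?thesis
    by (subst eq, intro borel_measurable_sum borel_measurable_continuous_on[OF cont] assms)
qed

lemma borel_measurable_cnj_complex [measurable (raw)]:
  assumes "f \<in> borel_measurable M" shows "(\<lambda>x. cnj (f x)) \<in> borel_measurable M"
  by (rule borel_measurable_continuous_on[OF _ assms]) (intro continuous_intros)

lemma borel_measurable_det [measurable (raw)]:
  fixes f :: "'a \<Rightarrow> complex ^ 'n ^ 'n"
  assumes [measurable]: "f \<in> borel_measurable M"
  shows "(\<lambda>x. det (f x)) \<in> borel_measurable M"
  unfolding det_def by measurable

text \<open>Serves measurability. On invertible matrices the entries of the inverse are quotients of
  determinants. On singular ones \<open>matrix_inv\<close> chooses from an unsatisfiable predicate,
  the same for all of them, so its value there is a constant, written as the value at 0.\<close>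

lemma matrix_inv_cramer:
  fixes A :: "complex ^ 'n ^ 'n"
  shows "matrix_inv A = (if det A = 0 then matrix_inv 0
     else (\<chi> k j. det (\<chi> i l. if l = k then axis j 1 $ i else A $ i $ l) / det A))"
proof (cases "det A = 0")
  case True
  have "det (0 :: complex ^ 'n ^ 'n) = 0"
    by (metis det_0 mat_0)
  hence "\<nexists>B. A ** B = mat 1 \<and> B ** A = mat 1" "\<nexists>B. (0 :: complex ^ 'n ^ 'n) ** B = mat 1 \<and> B ** 0 = mat 1"
    using True invertible_det_nz[of A] invertible_det_nz[of "0 :: complex ^ 'n ^ 'n"]
    by (auto simp only: invertible_def)
  hence "(\<lambda>B. A ** B = mat 1 \<and> B ** A = mat 1)
      = (\<lambda>B. (0 :: complex ^ 'n ^ 'n) ** B = mat 1 \<and> B ** 0 = mat 1)" by blast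
  thus ?thesis using True by (simp only: matrix_inv_def if_True simp_thms)
next
  case False
  have "A *v (matrix_inv A *v axis j 1) = axis j 1" for j
    using False by (simp add: matrix_vector_mul_assoc matrix_inv_inverse invertible_det_nz)
  hence inv: "matrix_inv A *v axis j 1
      = (\<chi> k. det (\<chi> i l. if l = k then axis j 1 $ i else A $ i $ l) / det A)" for j
    using iffD1[OF cramer[OF False]] by blast
  have "matrix_inv A $ k $ j = (matrix_inv A *v axis j 1) $ k" for k j
    by (simp add: matrix_vector_mult_def axis_def if_distrib cong: if_cong)
  hence "matrix_inv A $ k $ j = det (\<chi> i l. if l = k then axis j 1 $ i else A $ i $ l) / det A" for k j
    by (simp only: inv vec_lambda_beta)
  thus ?thesis using False by (simp add: vec_eq_iff)
qed

lemma borel_measurable_matrix_inv [measurable (raw)]: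
  fixes f :: "'a \<Rightarrow> complex ^ 'n ^ 'n"
  assumes [measurable]: "f \<in> borel_measurable M"
  shows "(\<lambda>x. matrix_inv (f x)) \<in> borel_measurable M"
proof -
  have [measurable]: "(\<lambda>x. (\<chi> i l. if l = k then axis j 1 $ i else f x $ i $ l) :: complex ^ 'n ^ 'n)
      \<in> borel_measurable M" for k j
  proof (intro borel_measurable_vecI)
    show "(\<lambda>x. ((\<chi> i l. if l = k then axis j 1 $ i else f x $ i $ l) :: complex ^ 'n ^ 'n) $ i $ l)
        \<in> borel_measurable M" for i l
      by (cases "l = k") simp_all
  qed
  have [measurable]: "(\<lambda>x. (\<chi> k j. det ((\<chi> i l. if l = k then axis j 1 $ i else f x $ i $ l) :: complex ^ 'n ^ 'n)
      / det (f x)) :: complex ^ 'n ^ 'n) \<in> borel_measurable M"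
    by (intro borel_measurable_vecI) simp
  show ?thesis by (subst matrix_inv_cramer) measurable
qed

lemma borel_measurable_matrix_mult [measurable (raw)]:
  fixes f g :: "'a \<Rightarrow> complex ^ 'n ^ 'n"
  assumes [measurable]: "f \<in> borel_measurable M" "g \<in> borel_measurable M"
  shows "(\<lambda>x. f x ** g x) \<in> borel_measurable M"
  by (intro borel_measurable_vecI) (simp add: matrix_matrix_mult_def)

lemma borel_measurable_trace [measurable (raw)]:
  fixes f :: "'a \<Rightarrow> complex ^ 'n ^ 'n"
  assumes [measurable]: "f \<in> borel_measurable M"
  shows "(\<lambda>x. trace (f x)) \<in> borel_measurable M"
  unfolding trace_def by measurable

lemma borel_measurable_outer [measurable (raw)]:
  fixes u :: "'a \<Rightarrow> complex ^ 'n"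
  assumes [measurable]: "u \<in> borel_measurable M"
  shows "(\<lambda>x. outer (u x)) \<in> borel_measurable M"
  by (intro borel_measurable_vecI) (simp add: outer_def)

lemma borel_measurable_quad_form [measurable (raw)]:
  fixes u :: "'a \<Rightarrow> complex ^ 'n"
  assumes [measurable]: "f \<in> borel_measurable M" "u \<in> borel_measurable M"
  shows "(\<lambda>x. quad_form (f x) (u x)) \<in> borel_measurable M"
  unfolding quad_form_def matrix_vector_mult_def vec_lambda_beta by measurable

lemma borel_measurable_W_mat [measurable (raw)]:
  fixes f :: "'a \<Rightarrow> complex ^ 'n ^ 'n"
  assumes [measurable]: "f \<in> borel_measurable M"
  shows "(\<lambda>x. W_mat \<delta> i (f x)) \<in> borel_measurable M"
proof (intro borel_measurable_vecI)
  show "(\<lambda>x. W_mat \<delta> i (f x) $ j $ k) \<in> borel_measurable M" for j k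
    unfolding W_mat_def Let_def vec_lambda_beta by measurable
qed

lemma borel_measurable_R_fun [measurable (raw)]:
  assumes [measurable]: "f \<in> borel_measurable N" "g \<in> measurable N M" "\<phi> \<in> borel_measurable M"
  shows "(\<lambda>p. R_fun \<phi> \<delta> \<kappa> i (f p) (g p)) \<in> borel_measurable N"
  unfolding R_fun_def w_fun_def by measurable

section \<open>The law of the sample\<close>

lemma divide_left_mono_ennreal:
  fixes a b c :: ennreal
  assumes "b \<le> c" shows "a / c \<le> a / b"
proof (cases "b = 0 \<or> c = top")
  case False
  then obtain x y where xy: "b = ennreal x" "c = ennreal y" "0 < x" "0 \<le> y"
    using assms by (cases b; cases c) (auto simp: top_unique)
  hence "x \<le> y" using assms by (simp add: ennreal_le_iff)
  hence "inverse c \<le> inverse b" using xy by (simp add: inverse_ennreal ennreal_leI le_imp_inverse_le)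
  thus ?thesis by (simp add: divide_ennreal_def mult_left_mono)
qed auto

locale sampler = prob_space M
  for M :: "'a measure" +
  fixes \<phi> :: "'a \<Rightarrow> complex ^ 'n" and \<delta> \<kappa> :: real
  assumes measurable_basis [measurable]: "\<phi> \<in> borel_measurable M"
    and \<delta>: "0 < \<delta>" "\<delta> < 1"
begin

abbreviation Pi_lt :: "nat \<Rightarrow> (nat \<Rightarrow> 'a) measure" where
  "Pi_lt i \<equiv> \<Pi>\<^sub>M j\<in>{..<i}. M"

abbreviation A where "A \<equiv> A_mat \<phi> \<delta> \<kappa>"
abbreviation R where "R i xs \<equiv> R_fun \<phi> \<delta> \<kappa> i (A xs i)"
abbreviation law where "law \<equiv> sample_law M \<phi> \<delta> \<kappa>"
abbreviation next_law where "next_law \<equiv> next_point M \<phi> \<delta> \<kappa>"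

definition mass :: "nat \<Rightarrow> (nat \<Rightarrow> 'a) \<Rightarrow> ennreal" where
  "mass i xs = (\<integral>\<^sup>+ x. ennreal (R i xs x) \<partial>M)"

lemma next_law_eq: "next_law xs i = density M (\<lambda>x. ennreal (R i xs x) / mass i xs)"
  by (simp add: next_point_def Let_def mass_def)

lemma A_upd: "i \<le> k \<Longrightarrow> A (xs(k := x)) i = A xs i"
  by (rule A_mat_cong) auto

lemma measurable_A [measurable]:
  assumes "i \<le> k" shows "(\<lambda>xs. A xs i) \<in> borel_measurable (Pi_lt k)"
  using assms
proof (induction i)
  case (Suc i)
  have [measurable]: "(\<lambda>xs. A xs i) \<in> borel_measurable (Pi_lt k)"
    using Suc by simp
  have [measurable]: "(\<lambda>xs. xs i) \<in> measurable (Pi_lt k) M"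
    using Suc.prems by (intro measurable_component_singleton) auto
  show ?case by simp
qed simp

lemma measurable_R_pair:
  "(\<lambda>p. R i (fst p) (snd p)) \<in> borel_measurable (Pi_lt i \<Otimes>\<^sub>M M)"
proof -
  have [measurable]: "(\<lambda>xs. A xs i) \<in> borel_measurable (Pi_lt i)" by simp
  show ?thesis by measurable
qed

lemma measurable_R_draw [measurable]:
  assumes "i < k" shows "(\<lambda>xs. R i xs (xs i)) \<in> borel_measurable (Pi_lt k)"
proof -
  have [measurable]: "(\<lambda>xs. A xs i) \<in> borel_measurable (Pi_lt k)" using assms by simp
  have [measurable]: "(\<lambda>xs. xs i) \<in> measurable (Pi_lt k) M"
    using assms by (intro measurable_component_singleton) auto
  show ?thesis by measurable
qed

lemma measurable_mass [measurable]: "mass i \<in> borel_measurable (Pi_lt i)"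
  unfolding mass_def[abs_def]
  using measurable_compose[OF measurable_R_pair measurable_ennreal]
  by (intro borel_measurable_nn_integral) (simp add: case_prod_unfold)

text \<open>The total mass is $1$, except that it is $0$ when \<open>mass i xs\<close> is $0$ or $\infty$,
  by the conventions of \<^typ>\<open>ennreal\<close>.\<close>

lemma subprob_next_law: "subprob_space (next_law xs i)"
proof (rule subprob_spaceI)
  have "emeasure (next_law xs i) (space (next_law xs i)) = (\<integral>\<^sup>+ x. ennreal (R i xs x) / mass i xs \<partial>M)"
    unfolding next_law_eq
    by (simp add: emeasure_density cong: nn_integral_cong)
  also have "\<dots> = mass i xs / mass i xs"
    by (simp add: nn_integral_divide mass_def)
  also have "\<dots> \<le> 1"
    by (cases "mass i xs = 0 \<or> mass i xs = top") (auto simp: ennreal_divide_self less_top)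
  finally show "emeasure (next_law xs i) (space (next_law xs i)) \<le> 1" .
  show "space (next_law xs i) \<noteq> {}"
    using not_empty by (simp add: next_law_eq)
qed

lemma measurable_next_law: "(\<lambda>xs. next_law xs i) \<in> measurable (Pi_lt i) (subprob_algebra M)"
proof (rule measurable_subprob_algebra)
  fix B assume [measurable]: "B \<in> sets M"
  have "(\<lambda>xs. \<integral>\<^sup>+ x. ennreal (R i xs x) / mass i xs * indicator B x \<partial>M) \<in> borel_measurable (Pi_lt i)"
  proof (intro borel_measurable_nn_integral)
    have [measurable]: "(\<lambda>p. R i (fst p) (snd p)) \<in> borel_measurable (Pi_lt i \<Otimes>\<^sub>M M)"
      by (rule measurable_R_pair)
    show "(\<lambda>(xs, x). ennreal (R i xs x) / mass i xs * indicator B x) \<in> borel_measurable (Pi_lt i \<Otimes>\<^sub>M M)"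
      unfolding case_prod_unfold by measurable
  qed
  thus "(\<lambda>xs. emeasure (next_law xs i) B) \<in> borel_measurable (Pi_lt i)"
    by (simp add: next_law_eq emeasure_density)
qed (simp_all add: subprob_next_law, simp add: next_law_eq)

section \<open>Transition kernels, iterated integrals and almost sure statements for the law\<close>

definition kernel :: "nat \<Rightarrow> (nat \<Rightarrow> 'a) \<Rightarrow> (nat \<Rightarrow> 'a) measure" where
  "kernel i xs = distr (next_law xs i) (Pi_lt (Suc i)) (\<lambda>x. xs(i := x))"

lemma law_Suc: "law (Suc i) = law i \<bind> kernel i"
  by (simp add: kernel_def[abs_def])

lemma measurable_extend: "(\<lambda>(xs, x). xs(i := x)) \<in> measurable (Pi_lt i \<Otimes>\<^sub>M M) (Pi_lt (Suc i))"
  using measurable_add_dim[of i "{..<i}" "\<lambda>_. M"] by (simp add: lessThan_Suc)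

lemma measurable_kernel: "kernel i \<in> measurable (Pi_lt i) (subprob_algebra (Pi_lt (Suc i)))"
  unfolding kernel_def[abs_def]
  by (rule measurable_distr2[OF _ measurable_next_law]) (rule measurable_extend)

lemma law_space: "law i \<in> space (subprob_algebra (Pi_lt i))"
proof (induction i)
  case 0
  show ?case
    by (auto simp: space_subprob_algebra space_PiM intro!: prob_space_imp_subprob_space prob_space_return)
next
  case (Suc i)
  hence sub: "subprob_space (law i)" and s: "sets (law i) = sets (Pi_lt i)"
    by (simp_all add: space_subprob_algebra)
  have k: "kernel i \<in> measurable (law i) (subprob_algebra (Pi_lt (Suc i)))"
    using measurable_kernel by (simp add: measurable_cong_sets[OF s refl])
  have "subprob_space (law i \<bind> kernel i)" by (rule subprob_space_bind[OF sub k])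
  moreover have "sets (law i \<bind> kernel i) = sets (Pi_lt (Suc i))"
    by (rule sets_bind_measurable[OF k subprob_space.subprob_not_empty[OF sub]])
  ultimately show ?case unfolding law_Suc space_subprob_algebra by blast
qed

lemma sets_law [measurable_cong]: "sets (law i) = sets (Pi_lt i)"
  and subprob_law: "subprob_space (law i)"
  using law_space[of i] by (simp_all add: space_subprob_algebra)

lemma measurable_kernel_law: "kernel i \<in> measurable (law i) (subprob_algebra (Pi_lt (Suc i)))"
  using measurable_kernel by (simp add: measurable_cong_sets[OF sets_law refl])

lemma space_law: "space (law i) = space (Pi_lt i)"
  by (rule sets_eq_imp_space_eq[OF sets_law])

lemma measurable_extend_fixed:
  assumes "xs \<in> space (Pi_lt i)"
  shows "(\<lambda>x. xs(i := x)) \<in> measurable (next_law xs i) (Pi_lt (Suc i))"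
  using measurable_compose[OF measurable_Pair1'[OF assms] measurable_extend]
  by (simp add: next_law_eq cong: measurable_cong_sets)

text \<open>This is how conditioning on the earlier points enters: the inner integral is the
  conditional expectation over the new draw.\<close>

lemma nn_integral_law_Suc:
  assumes "F \<in> borel_measurable (Pi_lt (Suc i))"
  shows "(\<integral>\<^sup>+ xs. F xs \<partial>law (Suc i)) = (\<integral>\<^sup>+ xs. \<integral>\<^sup>+ x. F (xs(i := x)) \<partial>next_law xs i \<partial>law i)"
  unfolding law_Suc nn_integral_bind[OF assms measurable_kernel_law] kernel_def
  by (intro nn_integral_cong nn_integral_distr measurable_extend_fixed)
     (use assms space_law in auto)

lemma AE_law_Suc:
  assumes "Measurable.pred (Pi_lt (Suc i)) Q"
  shows "(AE xs in law (Suc i). Q xs) \<longleftrightarrow> (AE xs in law i. AE x in next_law xs i. Q (xs(i := x)))"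
  unfolding law_Suc AE_bind[OF measurable_kernel_law assms] kernel_def
proof (rule AE_cong)
  fix xs assume "xs \<in> space (law i)"
  hence "xs \<in> space (Pi_lt i)" using space_law by simp
  thus "(AE xs in distr (next_law xs i) (Pi_lt (Suc i)) (\<lambda>x. xs(i := x)). Q xs)
      \<longleftrightarrow> (AE x in next_law xs i. Q (xs(i := x)))"
    using assms by (intro AE_distr_iff measurable_extend_fixed) (auto simp: pred_def)
qed

text \<open>The density of the next point vanishes where R is not positive, and being a density it
  charges no M-null set; so both properties hold almost surely for each new draw. With h constantly
  true this gives \<open>positive_draws\<close>; a bound on the residual as h serves the almost sure
  estimate.\<close>

lemma AE_draws:
  assumes [measurable]: "Measurable.pred M h" and h: "AE x in M. h x"
  shows "AE xs in law i. \<forall>j<i. 0 < R j xs (xs j) \<and> h (xs j)"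
proof (induction i)
  case (Suc i)
  have comp [measurable]: "(\<lambda>xs. xs j) \<in> measurable (Pi_lt (Suc i)) M" if "j < Suc i" for j
    using that by (intro measurable_component_singleton) auto
  have "Measurable.pred (Pi_lt (Suc i)) (\<lambda>xs. \<forall>j\<in>{..<Suc i}. 0 < R j xs (xs j) \<and> h (xs j))"
    by (intro pred_intros_finite) auto
  hence m: "Measurable.pred (Pi_lt (Suc i)) (\<lambda>xs. \<forall>j<Suc i. 0 < R j xs (xs j) \<and> h (xs j))"
    by (simp add: Ball_def)
  show ?case
    unfolding AE_law_Suc[OF m]
  proof (rule AE_mp[OF Suc AE_I2], intro impI)
    fix xs assume past: "\<forall>j<i. 0 < R j xs (xs j) \<and> h (xs j)"
    have "AE x in next_law xs i. 0 < R i xs x \<and> h x"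
      unfolding next_law_eq by (subst AE_density) (use h in \<open>auto simp: ennreal_zero_less_divide\<close>)
    thus "AE x in next_law xs i. \<forall>j<Suc i. 0 < R j (xs(i := x)) ((xs(i := x)) j) \<and> h ((xs(i := x)) j)"
    proof (rule AE_mp, intro AE_I2 impI allI)
      fix x j assume "0 < R i xs x \<and> h x" "j < Suc i"
      thus "0 < R j (xs(i := x)) ((xs(i := x)) j) \<and> h ((xs(i := x)) j)"
        using past by (cases "j = i") (auto simp: A_upd less_Suc_eq)
    qed
  qed
qed simp

lemma AE_positive_draws: "AE xs in law i. positive_draws \<phi> \<delta> \<kappa> xs i"
  using AE_draws[of "\<lambda>_. True" i] by (simp add: positive_draws_def)

section \<open>The weighted sum of squared residuals and its expectation\<close>

lemma weight_eq: "weight \<phi> \<delta> \<kappa> xs i = 1 / R i xs (xs i)"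
  by (simp add: weight_def)

text \<open>Each term is coerced to \<open>ennreal\<close> separately, so the last draw splits off
  without sign conditions. On \<open>positive_draws\<close> all weights are positive and nothing is
  truncated.\<close>

definition residual :: "('a \<Rightarrow> complex) \<Rightarrow> nat \<Rightarrow> (nat \<Rightarrow> 'a) \<Rightarrow> ennreal" where
  "residual g i xs = (\<Sum>j<i. ennreal (weight \<phi> \<delta> \<kappa> xs j * (cmod (g (xs j)))\<^sup>2))"

lemma measurable_residual [measurable]:
  assumes [measurable]: "g \<in> borel_measurable M"
  shows "residual g i \<in> borel_measurable (Pi_lt i)"
proof -
  have "(\<lambda>xs. ennreal (weight \<phi> \<delta> \<kappa> xs j * (cmod (g (xs j)))\<^sup>2)) \<in> borel_measurable (Pi_lt i)" if "j < i" for j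
  proof -
    have [measurable]: "(\<lambda>xs. R j xs (xs j)) \<in> borel_measurable (Pi_lt i)"
      using that by (rule measurable_R_draw)
    have [measurable]: "(\<lambda>xs. xs j) \<in> measurable (Pi_lt i) M"
      using that by (intro measurable_component_singleton) auto
    show ?thesis unfolding weight_eq by measurable
  qed
  thus ?thesis unfolding residual_def[abs_def] by (intro borel_measurable_sum) auto
qed

lemma expected_residual:
  fixes g :: "'a \<Rightarrow> complex"
  assumes [measurable]: "g \<in> borel_measurable M"
    and c: "0 < c" and mass: "\<And>i xs. positive_draws \<phi> \<delta> \<kappa> xs i \<Longrightarrow> ennreal c \<le> mass i xs"
  shows "(\<integral>\<^sup>+ xs. residual g i xs \<partial>law i)
     \<le> of_nat i * ((\<integral>\<^sup>+ x. ennreal ((cmod (g x))\<^sup>2) \<partial>M) / ennreal c)"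
proof (induction i)
  case (Suc i)
  let ?G = "\<integral>\<^sup>+ x. ennreal ((cmod (g x))\<^sup>2) \<partial>M"
  have step: "(\<integral>\<^sup>+ x. residual g (Suc i) (xs(i := x)) \<partial>next_law xs i) \<le> residual g i xs + ?G / ennreal c"
    if pos: "positive_draws \<phi> \<delta> \<kappa> xs i" for xs
  proof -
    interpret N: subprob_space "next_law xs i" by (rule subprob_next_law)
    have mN [measurable_cong]: "sets (next_law xs i) = sets M" by (simp add: next_law_eq)
    have "residual g (Suc i) (xs(i := x)) = residual g i xs + ennreal (1 / R i xs x * (cmod (g x))\<^sup>2)" for x
      unfolding residual_def by (simp add: weight_eq A_upd)
    hence "(\<integral>\<^sup>+ x. residual g (Suc i) (xs(i := x)) \<partial>next_law xs i)
        = residual g i xs * emeasure (next_law xs i) (space (next_law xs i))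
          + (\<integral>\<^sup>+ x. ennreal (1 / R i xs x * (cmod (g x))\<^sup>2) \<partial>next_law xs i)"
      by (simp add: nn_integral_add)
    also have "\<dots> \<le> residual g i xs * 1 + ?G / ennreal c"
    proof (intro add_mono mult_left_mono N.emeasure_space_le_1)
      have "(\<integral>\<^sup>+ x. ennreal (1 / R i xs x * (cmod (g x))\<^sup>2) \<partial>next_law xs i)
          = (\<integral>\<^sup>+ x. ennreal (R i xs x) / mass i xs * ennreal (1 / R i xs x * (cmod (g x))\<^sup>2) \<partial>M)"
        unfolding next_law_eq by (subst nn_integral_density) auto
      also have "\<dots> \<le> (\<integral>\<^sup>+ x. ennreal ((cmod (g x))\<^sup>2) / ennreal c \<partial>M)"
      proof (intro nn_integral_mono)
        fix x
        show "ennreal (R i xs x) / mass i xs * ennreal (1 / R i xs x * (cmod (g x))\<^sup>2)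
            \<le> ennreal ((cmod (g x))\<^sup>2) / ennreal c"
        \<comment> \<open>Importance sampling: the weight 1/R cancels the R in the density and
          leaves |g|^2 / mass. Elsewhere the left side is 0, which is why only an inequality is
          claimed.\<close>
        proof (cases "R i xs x > 0")
          case True
          have "ennreal (R i xs x) * ennreal (1 / R i xs x * (cmod (g x))\<^sup>2) = ennreal ((cmod (g x))\<^sup>2)"
            using True by (subst ennreal_mult[symmetric]) auto
          hence "ennreal (R i xs x) / mass i xs * ennreal (1 / R i xs x * (cmod (g x))\<^sup>2)
              = ennreal ((cmod (g x))\<^sup>2) / mass i xs"
            by (simp add: divide_ennreal_def mult_ac)
          also have "\<dots> \<le> ennreal ((cmod (g x))\<^sup>2) / ennreal c"
            by (rule divide_left_mono_ennreal[OF mass[OF pos]])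
          finally show ?thesis .
        qed (simp add: ennreal_neg)
      qed
      also have "\<dots> = ?G / ennreal c" by (simp add: nn_integral_divide)
      finally show "(\<integral>\<^sup>+ x. ennreal (1 / R i xs x * (cmod (g x))\<^sup>2) \<partial>next_law xs i) \<le> ?G / ennreal c" .
    qed simp
    finally show ?thesis by simp
  qed
  have "(\<integral>\<^sup>+ xs. residual g (Suc i) xs \<partial>law (Suc i)) \<le> (\<integral>\<^sup>+ xs. residual g i xs + ?G / ennreal c \<partial>law i)"
    unfolding nn_integral_law_Suc[OF measurable_residual[OF assms(1)]]
    by (rule nn_integral_mono_AE, rule AE_mp[OF AE_positive_draws]) (auto intro: step)
  also have "\<dots> = (\<integral>\<^sup>+ xs. residual g i xs \<partial>law i) + ?G / ennreal c * emeasure (law i) (space (law i))"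
    by (simp add: nn_integral_add)
  also have "\<dots> \<le> of_nat i * (?G / ennreal c) + ?G / ennreal c * 1"
    using Suc by (intro add_mono mult_left_mono subprob_space.emeasure_space_le_1 subprob_law)
       auto
  finally show ?case by (simp add: algebra_simps)
qed (simp add: residual_def)

end

section \<open>Orthonormal bases and the approximation error\<close>

lemma L2norm_power2: "(L2norm M g)\<^sup>2 = (\<integral>\<^sup>+ x. ennreal ((cmod (g x))\<^sup>2) \<partial>M)"
proof (cases "(\<integral>\<^sup>+ x. ennreal ((cmod (g x))\<^sup>2) \<partial>M)")
  case (real r)
  thus ?thesis by (simp add: L2norm_def Let_def ennreal_power)
qed (simp add: L2norm_def Let_def)

lemma L2norm_le:
  assumes "(\<integral>\<^sup>+ x. ennreal ((cmod (g x))\<^sup>2) \<partial>M) \<le> ennreal (B\<^sup>2)" "0 \<le> B"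
  shows "L2norm M g \<le> ennreal B"
proof (cases "(\<integral>\<^sup>+ x. ennreal ((cmod (g x))\<^sup>2) \<partial>M)")
  case (real r)
  hence "r \<le> B\<^sup>2" using assms by (simp add: ennreal_le_iff)
  hence "sqrt r \<le> B" using assms(2) real_le_lsqrt by blast
  thus ?thesis using real by (simp add: L2norm_def Let_def ennreal_leI)
next
  case top
  thus ?thesis using assms by (simp add: top_unique)
qed

lemma L2norm_finite_iff:
  "L2norm M g < \<infinity> \<longleftrightarrow> (\<integral>\<^sup>+ x. ennreal ((cmod (g x))\<^sup>2) \<partial>M) < \<infinity>"
  by (auto simp: L2norm_def Let_def less_top[symmetric])

lemma L2_funs_iff:
  "g \<in> L2_funs M \<longleftrightarrow> g \<in> borel_measurable M \<and> integrable M (\<lambda>x. (cmod (g x))\<^sup>2)"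
  using L2norm_finite_iff[of M g] by (auto simp: L2_funs_def integrable_iff_bounded)

lemma L2_funs_measurable: "g \<in> L2_funs M \<Longrightarrow> g \<in> borel_measurable M"
  by (simp add: L2_funs_def)

lemma cmod_add_power2_le: "(cmod (a + b))\<^sup>2 \<le> 2 * (cmod a)\<^sup>2 + 2 * (cmod b)\<^sup>2"
proof -
  have "(cmod (a + b))\<^sup>2 \<le> (cmod a + cmod b)\<^sup>2"
    by (intro power_mono norm_triangle_ineq) auto
  also have "\<dots> \<le> 2 * (cmod a)\<^sup>2 + 2 * (cmod b)\<^sup>2"
    using zero_le_power2[of "cmod a - cmod b"] by (simp add: power2_eq_square algebra_simps)
  finally show ?thesis .
qed

lemma L2_funs_add:
  assumes "g \<in> L2_funs M" "h \<in> L2_funs M" shows "(\<lambda>x. g x + h x) \<in> L2_funs M"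
proof -
  have [measurable]: "g \<in> borel_measurable M" "h \<in> borel_measurable M"
    using assms by (auto simp: L2_funs_iff)
  have "integrable M (\<lambda>x. (cmod (g x + h x))\<^sup>2)"
  proof (rule Bochner_Integration.integrable_bound)
    show "integrable M (\<lambda>x. 2 * (cmod (g x))\<^sup>2 + 2 * (cmod (h x))\<^sup>2)"
      using assms by (auto simp: L2_funs_iff)
    show "AE x in M. norm ((cmod (g x + h x))\<^sup>2) \<le> norm (2 * (cmod (g x))\<^sup>2 + 2 * (cmod (h x))\<^sup>2)"
      by (intro AE_I2) (use cmod_add_power2_le in auto)
  qed measurable
  thus ?thesis by (simp add: L2_funs_iff)
qed

lemma L2_funs_cmult:
  assumes "g \<in> L2_funs M" shows "(\<lambda>x. c * g x) \<in> L2_funs M"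
  using assms by (auto simp: L2_funs_iff norm_mult power_mult_distrib)

lemma L2_funs_diff:
  assumes "g \<in> L2_funs M" "h \<in> L2_funs M" shows "(\<lambda>x. g x - h x) \<in> L2_funs M"
  using L2_funs_add[OF assms(1) L2_funs_cmult[OF assms(2), of "-1"]] by simp

lemma L2_funs_integrable_mult:
  assumes "g \<in> L2_funs M" "h \<in> L2_funs M" shows "integrable M (\<lambda>x. g x * cnj (h x))"
proof (rule Bochner_Integration.integrable_bound)
  have [measurable]: "g \<in> borel_measurable M" "h \<in> borel_measurable M"
    using assms by (auto simp: L2_funs_iff)
  show "(\<lambda>x. g x * cnj (h x)) \<in> borel_measurable M" by measurable
  show "integrable M (\<lambda>x. (cmod (g x))\<^sup>2 + (cmod (h x))\<^sup>2)"
    using assms by (auto simp: L2_funs_iff)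
  have "a * b \<le> a\<^sup>2 + b\<^sup>2" if "a \<ge> 0" "b \<ge> 0" for a b :: real
    using zero_le_power2[of "a - b"] mult_nonneg_nonneg[OF that] by (simp add: power2_eq_square algebra_simps)
  thus "AE x in M. norm (g x * cnj (h x)) \<le> norm ((cmod (g x))\<^sup>2 + (cmod (h x))\<^sup>2)"
    by (intro AE_I2) (simp add: norm_mult)
qed

locale orthonormal_sampler = sampler M \<phi> \<delta> \<kappa>
  for M :: "'a measure" and \<phi> :: "'a \<Rightarrow> complex ^ 'n" and \<delta> \<kappa> :: real +
  assumes basis_L2: "\<And>j. (\<lambda>x. \<phi> x $ j) \<in> L2_funs M"
    and orthonormal: "\<And>j k. (\<integral>x. \<phi> x $ j * cnj (\<phi> x $ k) \<partial>M) = (if j = k then 1 else 0)"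
begin

lemma integrable_basis_mult: "integrable M (\<lambda>x. \<phi> x $ j * cnj (\<phi> x $ k))"
  by (intro L2_funs_integrable_mult basis_L2)

text \<open>Orthonormality says that the mean of \<open>outer (\<phi> x)\<close> is the identity.
  This ties the mass of the sampling density to Tr W.\<close>

lemma integral_quad_form:
  "integrable M (\<lambda>x. quad_form W (\<phi> x))" "(\<integral>x. quad_form W (\<phi> x) \<partial>M) = trace W"
proof -
  have eq: "quad_form W (\<phi> x) = (\<Sum>j\<in>UNIV. \<Sum>k\<in>UNIV. W $ j $ k * (\<phi> x $ k * cnj (\<phi> x $ j)))" for x
    by (simp add: quad_form_def matrix_vector_mult_def sum_distrib_left mult_ac)
  show "integrable M (\<lambda>x. quad_form W (\<phi> x))"
    unfolding eq by (intro Bochner_Integration.integrable_sum integrable_mult_right integrable_basis_mult)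
  have "(\<integral>x. quad_form W (\<phi> x) \<partial>M)
      = (\<Sum>j\<in>UNIV. \<Sum>k\<in>UNIV. W $ j $ k * (\<integral>x. \<phi> x $ k * cnj (\<phi> x $ j) \<partial>M))"
    unfolding eq by (simp add: integrable_basis_mult)
  also have "\<dots> = trace W" by (simp add: orthonormal trace_def if_distrib cong: if_cong)
  finally show "(\<integral>x. quad_form W (\<phi> x) \<partial>M) = trace W" .
qed

text \<open>For \<kappa> = 0 the function R is the positive part of w, so its integral is at least
  that of w, which is Tr W.\<close>

lemma mass_ge:
  assumes \<kappa>: "\<kappa> = 0" and pos: "positive_draws \<phi> \<delta> \<kappa> xs i"
  shows "ennreal ((1 - \<delta>) / \<delta>) \<le> mass i xs"
proof -
  interpret barrier_step \<delta> i "A xs i"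
    using barrier_inv_A_mat[OF \<delta> pos] \<delta> by unfold_locales
  let ?W = "W_mat \<delta> i (A xs i)"
  have int: "integrable M (\<lambda>x. Re (quad_form ?W (\<phi> x)))"
    using integral_quad_form(1)[of ?W] by simp
  have "(1 - \<delta>) / \<delta> \<le> Re (trace ?W)" by (rule trace_W_ge)
  also have "\<dots> = (\<integral>x. Re (quad_form ?W (\<phi> x)) \<partial>M)"
    using integral_quad_form[of ?W] by (simp add: integral_Re)
  also have "\<dots> \<le> (\<integral>x. max 0 (Re (quad_form ?W (\<phi> x))) \<partial>M)"
    using int by (intro integral_mono integrable_max) auto
  finally have "ennreal ((1 - \<delta>) / \<delta>) \<le> ennreal (\<integral>x. max 0 (Re (quad_form ?W (\<phi> x))) \<partial>M)"
    by (rule ennreal_leI)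
  also have "\<dots> = (\<integral>\<^sup>+ x. ennreal (max 0 (Re (quad_form ?W (\<phi> x)))) \<partial>M)"
    using int by (intro nn_integral_eq_integral[symmetric] integrable_max) auto
  also have "\<dots> = mass i xs"
    unfolding mass_def by (intro nn_integral_cong) (simp add: \<kappa> R_fun_def w_fun_def max_def)
  finally show ?thesis .
qed

lemma lin_comb_L2: "lin_comb \<phi> c \<in> L2_funs M"
proof -
  have "(\<lambda>x. \<Sum>j\<in>J. c $ j * \<phi> x $ j) \<in> L2_funs M" if "finite J" for J
    using that
  proof induction
    case empty
    show ?case by (simp add: L2_funs_iff)
  next
    case (insert j J)
    show ?case using L2_funs_add[OF L2_funs_cmult[OF basis_L2] insert.IH, of "c $ j" j] insert by simp
  qed
  thus ?thesis unfolding lin_comb_def by simp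
qed

lemma integral_mult_lin_comb:
  assumes "g \<in> L2_funs M"
  shows "(\<integral>x. g x * cnj (lin_comb \<phi> c x) \<partial>M) = (\<Sum>j\<in>UNIV. cnj (c $ j) * (\<integral>x. g x * cnj (\<phi> x $ j) \<partial>M))"
proof -
  have "(\<integral>x. g x * cnj (lin_comb \<phi> c x) \<partial>M)
      = (\<integral>x. (\<Sum>j\<in>UNIV. cnj (c $ j) * (g x * cnj (\<phi> x $ j))) \<partial>M)"
    by (simp add: lin_comb_def sum_distrib_left mult_ac)
  also have "\<dots> = (\<Sum>j\<in>UNIV. cnj (c $ j) * (\<integral>x. g x * cnj (\<phi> x $ j) \<partial>M))"
    using L2_funs_integrable_mult[OF assms basis_L2] by simp
  finally show ?thesis .
qed

lemma integral_lin_comb_basis: "(\<integral>x. lin_comb \<phi> c x * cnj (\<phi> x $ k) \<partial>M) = c $ k"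
proof -
  have "(\<integral>x. lin_comb \<phi> c x * cnj (\<phi> x $ k) \<partial>M)
      = (\<integral>x. (\<Sum>j\<in>UNIV. c $ j * (\<phi> x $ j * cnj (\<phi> x $ k))) \<partial>M)"
    by (simp only: lin_comb_def sum_distrib_right mult.assoc)
  also have "\<dots> = c $ k"
    by (simp add: integrable_basis_mult orthonormal if_distrib cong: if_cong)
  finally show ?thesis .
qed

lemma integral_lin_comb_power2: "(\<integral>x. (cmod (lin_comb \<phi> c x))\<^sup>2 \<partial>M) = (norm c)\<^sup>2"
proof -
  have "complex_of_real (\<integral>x. (cmod (lin_comb \<phi> c x))\<^sup>2 \<partial>M)
      = (\<integral>x. lin_comb \<phi> c x * cnj (lin_comb \<phi> c x) \<partial>M)"
    unfolding integral_complex_of_real[symmetric] by (simp only: complex_norm_square)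
  also have "\<dots> = complex_of_real ((norm c)\<^sup>2)"
    unfolding integral_mult_lin_comb[OF lin_comb_L2] integral_lin_comb_basis cdot_self[symmetric] cdot_def ..
  finally show ?thesis by (simp only: of_real_eq_iff)
qed

lemma nn_integral_lin_comb_power2: "(\<integral>\<^sup>+ x. ennreal ((cmod (lin_comb \<phi> c x))\<^sup>2) \<partial>M) = ennreal ((norm c)\<^sup>2)"
  using lin_comb_L2[of c]
  by (simp add: nn_integral_eq_integral L2_funs_iff integral_lin_comb_power2)

lemma pythagoras:
  assumes g: "g \<in> L2_funs M" and orth: "\<And>j. (\<integral>x. g x * cnj (\<phi> x $ j) \<partial>M) = 0"
  shows "(\<integral>\<^sup>+ x. ennreal ((cmod (g x - lin_comb \<phi> c x))\<^sup>2) \<partial>M)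
    = (\<integral>\<^sup>+ x. ennreal ((cmod (g x))\<^sup>2) \<partial>M) + ennreal ((norm c)\<^sup>2)"
proof -
  let ?h = "lin_comb \<phi> c"
  have int: "integrable M (\<lambda>x. (cmod (g x))\<^sup>2)" "integrable M (\<lambda>x. (cmod (?h x))\<^sup>2)"
      "integrable M (\<lambda>x. (cmod (g x - ?h x))\<^sup>2)"
    using g lin_comb_L2 L2_funs_diff[OF g lin_comb_L2] by (auto simp: L2_funs_iff)
  have intm: "integrable M (\<lambda>x. Re (g x * cnj (?h x)))"
    using L2_funs_integrable_mult[OF g lin_comb_L2] by (rule integrable_Re)
  have "(\<integral>x. g x * cnj (?h x) \<partial>M) = 0" by (simp add: integral_mult_lin_comb[OF g] orth)
  hence 0: "(\<integral>x. Re (g x * cnj (?h x)) \<partial>M) = 0"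
    using integral_Re[OF L2_funs_integrable_mult[OF g lin_comb_L2[of c]]] by simp
  have "(cmod (a - b))\<^sup>2 = (cmod a)\<^sup>2 + (cmod b)\<^sup>2 - 2 * Re (a * cnj b)" for a b
    unfolding cmod_power2 by (simp add: power2_eq_square algebra_simps)
  hence "(\<integral>x. (cmod (g x - ?h x))\<^sup>2 \<partial>M)
      = (\<integral>x. (cmod (g x))\<^sup>2 + (cmod (?h x))\<^sup>2 - 2 * Re (g x * cnj (?h x)) \<partial>M)" by presburger
  also have "\<dots> = (\<integral>x. (cmod (g x))\<^sup>2 \<partial>M) + (\<integral>x. (cmod (?h x))\<^sup>2 \<partial>M) - 2 * (\<integral>x. Re (g x * cnj (?h x)) \<partial>M)"
    using int intm by (simp del: times_complex.simps)
  finally have "(\<integral>x. (cmod (g x - ?h x))\<^sup>2 \<partial>M) = (\<integral>x. (cmod (g x))\<^sup>2 \<partial>M) + (norm c)\<^sup>2"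
    by (simp only: 0 integral_lin_comb_power2 mult_zero_right diff_zero)
  thus ?thesis using int by (simp add: nn_integral_eq_integral ennreal_plus)
qed

lemma projection_orthogonal:
  assumes "f \<in> L2_funs M"
  defines "c \<equiv> \<chi> j. \<integral>x. f x * cnj (\<phi> x $ j) \<partial>M"
  shows "(\<integral>x. (f x - lin_comb \<phi> c x) * cnj (\<phi> x $ j) \<partial>M) = 0"
  using L2_funs_integrable_mult[OF assms(1) basis_L2[of j]]
    L2_funs_integrable_mult[OF lin_comb_L2[of c] basis_L2[of j]]
  by (simp add: left_diff_distrib integral_lin_comb_basis) (simp add: c_def)

section \<open>The two error bounds for a fixed comparison function\<close>

lemma expected_error:
  assumes \<kappa>: "\<kappa> = 0" and f: "f \<in> L2_funs M"
    and l: "0 < barrier CARD('n) \<delta> CARD('n) + 1" (is "0 < ?l")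
    and orth: "\<And>j. (\<integral>x. (f x - lin_comb \<phi> c0 x) * cnj (\<phi> x $ j) \<partial>M) = 0"
  shows "(\<integral>\<^sup>+ xs. (L2norm M (\<lambda>x. f x - sample_approx \<phi> \<delta> \<kappa> CARD('n) f xs x))\<^sup>2 \<partial>law CARD('n))
    \<le> ennreal (1 + real CARD('n) / (?l * ((1 - \<delta>) / \<delta>))) * (L2norm M (\<lambda>x. f x - lin_comb \<phi> c0 x))\<^sup>2"
proof -
  define g where "g x = f x - lin_comb \<phi> c0 x" for x
  define G where "G = (L2norm M g)\<^sup>2"
  have g: "g \<in> L2_funs M" unfolding g_def[abs_def] by (intro L2_funs_diff f lin_comb_L2)
  have [measurable]: "g \<in> borel_measurable M" using g by (rule L2_funs_measurable)
  have orth': "(\<integral>x. g x * cnj (\<phi> x $ j) \<partial>M) = 0" for j using orth by (simp add: g_def)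
  have \<gamma>: "0 < (1 - \<delta>) / \<delta>" (is "0 < ?\<gamma>") using \<delta> by simp
  have error: "(L2norm M (\<lambda>x. f x - sample_approx \<phi> \<delta> \<kappa> CARD('n) f xs x))\<^sup>2
      \<le> G + ennreal (1 / ?l) * residual g CARD('n) xs"
    if pos: "positive_draws \<phi> \<delta> \<kappa> xs CARD('n)" for xs
  proof -
    obtain c where c: "sample_approx \<phi> \<delta> \<kappa> CARD('n) f xs = lin_comb \<phi> (c0 + c)"
      and le: "?l * (norm c)\<^sup>2 \<le> (\<Sum>j<CARD('n). weight \<phi> \<delta> \<kappa> xs j * (cmod (g (xs j)))\<^sup>2)"
      using sample_approx_error[OF \<delta> pos l, of f c0] unfolding g_def by blast
    have w: "weight \<phi> \<delta> \<kappa> xs j \<ge> 0" if "j < CARD('n)" for j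
      using pos that by (simp add: positive_draws_def weight_def less_imp_le)
    have "ennreal ((norm c)\<^sup>2) \<le> ennreal (1 / ?l * (\<Sum>j<CARD('n). weight \<phi> \<delta> \<kappa> xs j * (cmod (g (xs j)))\<^sup>2))"
      using le l by (intro ennreal_leI) (simp add: field_simps)
    also have "\<dots> = ennreal (1 / ?l) * residual g CARD('n) xs"
      unfolding residual_def using l w by (subst ennreal_mult') (auto intro!: arg_cong2[where f = "(*)"] sum_ennreal[symmetric])
    finally have "ennreal ((norm c)\<^sup>2) \<le> ennreal (1 / ?l) * residual g CARD('n) xs" .
    moreover have "(L2norm M (\<lambda>x. f x - sample_approx \<phi> \<delta> \<kappa> CARD('n) f xs x))\<^sup>2 = G + ennreal ((norm c)\<^sup>2)"
      using pythagoras[OF g orth', of c] by (simp add: c L2norm_power2 G_def g_def lin_comb_add diff_diff_eq)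
    ultimately show ?thesis by (simp add: add_left_mono)
  qed
  have "(\<integral>\<^sup>+ xs. (L2norm M (\<lambda>x. f x - sample_approx \<phi> \<delta> \<kappa> CARD('n) f xs x))\<^sup>2 \<partial>law CARD('n))
      \<le> (\<integral>\<^sup>+ xs. G + ennreal (1 / ?l) * residual g CARD('n) xs \<partial>law CARD('n))"
    by (rule nn_integral_mono_AE, rule AE_mp[OF AE_positive_draws]) (auto intro: error)
  also have "\<dots> = G * emeasure (law CARD('n)) (space (law CARD('n)))
      + ennreal (1 / ?l) * (\<integral>\<^sup>+ xs. residual g CARD('n) xs \<partial>law CARD('n))"
    by (simp add: nn_integral_add nn_integral_cmult)
  \<comment> \<open>The first G is the orthogonal part of the error. In the second term each of the
    n draws costs at most G / ?\<gamma>, and the stability constant ?l converts the sampled norm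
    back. The law enters only through its total mass being at most 1.\<close>
  also have "\<dots> \<le> G * 1 + ennreal (1 / ?l) * (of_nat CARD('n) * (G / ennreal ?\<gamma>))"
    unfolding G_def L2norm_power2
    by (intro add_mono mult_left_mono subprob_space.emeasure_space_le_1 subprob_law expected_residual
        \<gamma> mass_ge \<kappa>) auto
  also have "\<dots> = ennreal (1 + real CARD('n) / (?l * ?\<gamma>)) * G"
  proof -
    have "G / ennreal ?\<gamma> = ennreal (1 / ?\<gamma>) * G"
      using \<gamma> by (simp add: divide_ennreal_def inverse_ennreal mult.commute inverse_eq_divide)
    hence "ennreal (1 / ?l) * (of_nat CARD('n) * (G / ennreal ?\<gamma>))
        = (ennreal (1 / ?l) * ennreal (real CARD('n)) * ennreal (1 / ?\<gamma>)) * G"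
      by (simp add: mult.assoc ennreal_of_nat_eq_real_of_nat)
    also have "ennreal (1 / ?l) * ennreal (real CARD('n)) * ennreal (1 / ?\<gamma>) = ennreal (real CARD('n) / (?l * ?\<gamma>))"
    proof -
      have "0 \<le> 1 / ?l" "0 \<le> 1 / ?l * real CARD('n)" using l by simp_all
      moreover have "1 / ?l * real CARD('n) * (1 / ?\<gamma>) = real CARD('n) / (?l * ?\<gamma>)" by simp
      ultimately show ?thesis by (simp only: ennreal_mult'[symmetric])
    qed
    moreover have "ennreal (1 + real CARD('n) / (?l * ?\<gamma>)) = 1 + ennreal (real CARD('n) / (?l * ?\<gamma>))"
      using l \<delta> by (subst ennreal_plus) auto
    ultimately show ?thesis by (simp only: distrib_right mult_1 mult_1_right)
  qed
  finally show ?thesis by (simp add: G_def g_def[abs_def])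
qed

text \<open>Truncation at \<kappa> = 1 makes every drawn R at least (1 - \<delta>) / \<delta>, so
  the weights are bounded and no expectation is taken: the estimate holds for each sample with
  positive draws at which |g| \<le> C. The constant b will be n.\<close>

lemma sup_error:
  assumes \<kappa>: "\<kappa> = 1" and [measurable]: "f \<in> borel_measurable M"
    and l: "0 < barrier CARD('n) \<delta> CARD('n) + 1" (is "0 < ?l")
    and bound: "real CARD('n) / ((barrier CARD('n) \<delta> CARD('n) + 1) * ((1 - \<delta>) / \<delta>)) \<le> (2 * b)\<^sup>2" and b: "b > 0"
    and C: "0 \<le> C" and g: "AE x in M. cmod (f x - lin_comb \<phi> c0 x) \<le> C"
  shows "AE xs in law CARD('n).
    L2norm M (\<lambda>x. f x - sample_approx \<phi> \<delta> \<kappa> CARD('n) f xs x) \<le> ennreal ((2 * b + 1) * C)"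
proof -
  define g where "g x = f x - lin_comb \<phi> c0 x" for x
  have [measurable]: "lin_comb \<phi> c \<in> borel_measurable M" for c
    using lin_comb_L2 by (rule L2_funs_measurable)
  have [measurable]: "g \<in> borel_measurable M" unfolding g_def[abs_def] by measurable
  have gC: "AE x in M. cmod (g x) \<le> C" using assms(7) by (simp add: g_def)
  have \<gamma>: "0 < (1 - \<delta>) / \<delta>" (is "0 < ?\<gamma>") using \<delta> by simp
  have "L2norm M (\<lambda>x. f x - sample_approx \<phi> \<delta> \<kappa> CARD('n) f xs x) \<le> ennreal ((2 * b + 1) * C)"
    if xs: "\<forall>j<CARD('n). 0 < R j xs (xs j) \<and> cmod (g (xs j)) \<le> C" for xs
  proof -
    have pos: "positive_draws \<phi> \<delta> \<kappa> xs CARD('n)" using xs by (simp add: positive_draws_def)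
    obtain c where c: "sample_approx \<phi> \<delta> \<kappa> CARD('n) f xs = lin_comb \<phi> (c0 + c)"
      and le: "?l * (norm c)\<^sup>2 \<le> (\<Sum>j<CARD('n). weight \<phi> \<delta> \<kappa> xs j * (cmod (g (xs j)))\<^sup>2)"
      using sample_approx_error[OF \<delta> pos l, of f c0] unfolding g_def by blast
    have "weight \<phi> \<delta> \<kappa> xs j * (cmod (g (xs j)))\<^sup>2 \<le> 1 / ?\<gamma> * C\<^sup>2" if "j < CARD('n)" for j
    proof (intro mult_mono power_mono)
      have "R j xs (xs j) \<ge> ?\<gamma>"
        using xs that \<kappa> by (auto simp: R_fun_def split: if_splits)
      thus "weight \<phi> \<delta> \<kappa> xs j \<le> 1 / ?\<gamma>"
        unfolding weight_eq using \<gamma> by (intro divide_left_mono mult_pos_pos) (auto simp del: zero_less_divide_iff)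
    qed (use xs that \<delta> in auto)
    hence "(\<Sum>j<CARD('n). weight \<phi> \<delta> \<kappa> xs j * (cmod (g (xs j)))\<^sup>2) \<le> real CARD('n) * (1 / ?\<gamma> * C\<^sup>2)"
      using sum_bounded_above[of "{..<CARD('n)}" "\<lambda>j. weight \<phi> \<delta> \<kappa> xs j * (cmod (g (xs j)))\<^sup>2" "1 / ?\<gamma> * C\<^sup>2"]
      by (simp only: lessThan_iff card_lessThan)
    with le have "?l * (norm c)\<^sup>2 \<le> real CARD('n) * (1 / ?\<gamma> * C\<^sup>2)" by linarith
    hence "(norm c)\<^sup>2 \<le> real CARD('n) * (1 / ?\<gamma> * C\<^sup>2) / ?l"
      using l by (simp only: pos_le_divide_eq mult.commute)
    also have "\<dots> = real CARD('n) / (?l * ?\<gamma>) * C\<^sup>2" by (simp add: mult_ac)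
    also have "\<dots> \<le> (2 * b)\<^sup>2 * C\<^sup>2" by (intro mult_right_mono bound) simp
    finally have normc: "(norm c)\<^sup>2 \<le> (2 * b)\<^sup>2 * C\<^sup>2" .
    \<comment> \<open>Weighted Young inequality in place of Minkowski's. The parameter 2b is the
      ratio of the bounds 2bC and C for the two norms, so that integration yields exactly (2b + 1)^2
      C^2.\<close>
    have pointwise: "(cmod (u - v))\<^sup>2 \<le> (1 + 2 * b) * C\<^sup>2 + (1 + 1 / (2 * b)) * (cmod v)\<^sup>2"
      if "cmod u \<le> C" for u v
    proof -
      have "(cmod (u - v))\<^sup>2 \<le> (C + cmod v)\<^sup>2"
        using norm_triangle_ineq4[of u v] that by (intro power_mono) auto
      moreover have "0 \<le> (2 * b * C - cmod v)\<^sup>2 / (2 * b)" using b by simp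
      moreover have "(2 * b * C - cmod v)\<^sup>2 / (2 * b) = 2 * b * C\<^sup>2 - 2 * C * cmod v + (cmod v)\<^sup>2 / (2 * b)"
        using b by (simp add: power2_eq_square field_simps)
      ultimately show ?thesis by (simp add: power2_eq_square algebra_simps)
    qed
    have "(\<integral>\<^sup>+ x. ennreal ((cmod (g x - lin_comb \<phi> c x))\<^sup>2) \<partial>M)
        \<le> (\<integral>\<^sup>+ x. ennreal ((1 + 2 * b) * C\<^sup>2) + ennreal (1 + 1 / (2 * b)) * ennreal ((cmod (lin_comb \<phi> c x))\<^sup>2) \<partial>M)"
    proof (rule nn_integral_mono_AE, rule AE_mp[OF gC AE_I2], intro impI)
      fix x assume "cmod (g x) \<le> C"
      thus "ennreal ((cmod (g x - lin_comb \<phi> c x))\<^sup>2)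
          \<le> ennreal ((1 + 2 * b) * C\<^sup>2) + ennreal (1 + 1 / (2 * b)) * ennreal ((cmod (lin_comb \<phi> c x))\<^sup>2)"
        using b pointwise[of "g x" "lin_comb \<phi> c x"]
        by (simp add: ennreal_mult[symmetric] ennreal_plus[symmetric] ennreal_leI del: ennreal_plus)
    qed
    also have "\<dots> = ennreal ((1 + 2 * b) * C\<^sup>2) + ennreal (1 + 1 / (2 * b)) * ennreal ((norm c)\<^sup>2)"
      by (simp add: nn_integral_add nn_integral_cmult nn_integral_lin_comb_power2 emeasure_space_1)
    also have "\<dots> = ennreal ((1 + 2 * b) * C\<^sup>2 + (1 + 1 / (2 * b)) * (norm c)\<^sup>2)"
      using b by (simp add: ennreal_mult[symmetric] ennreal_plus[symmetric] del: ennreal_plus)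
    also have "\<dots> \<le> ennreal (((2 * b + 1) * C)\<^sup>2)"
    proof (rule ennreal_leI)
      have "(1 + 1 / (2 * b)) * (norm c)\<^sup>2 \<le> (1 + 1 / (2 * b)) * ((2 * b)\<^sup>2 * C\<^sup>2)"
        using b by (intro mult_left_mono normc) auto
      also have "\<dots> = (2 * b * (2 * b + 1)) * C\<^sup>2" using b by (simp add: field_simps power2_eq_square)
      finally show "(1 + 2 * b) * C\<^sup>2 + (1 + 1 / (2 * b)) * (norm c)\<^sup>2 \<le> ((2 * b + 1) * C)\<^sup>2"
        by (simp add: power2_eq_square algebra_simps)
    qed
    finally have "L2norm M (\<lambda>x. g x - lin_comb \<phi> c x) \<le> ennreal ((2 * b + 1) * C)"
      using b C by (intro L2norm_le) auto
    thus ?thesis by (simp add: c g_def lin_comb_add diff_diff_eq)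
  qed
  moreover have "AE xs in law CARD('n). \<forall>j<CARD('n). 0 < R j xs (xs j) \<and> cmod (g (xs j)) \<le> C"
    by (rule AE_draws[OF _ gC]) measurable
  ultimately show ?thesis by (auto elim!: AE_mp)
qed

end

section \<open>The step size, and passage to the infimum\<close>

lemma step_size_facts:
  fixes \<delta> :: real
  assumes n: "n \<ge> 2" and \<delta>_def: "\<delta> = sqrt (1 - 1 / real n)"
  shows "0 < \<delta>" "\<delta> < 1" "0 < barrier n \<delta> n + 1"
    and "real n / ((barrier n \<delta> n + 1) * ((1 - \<delta>) / \<delta>)) \<le> (2 * real n)\<^sup>2"
proof -
  have n0: "real n > 0" "1 / real n < 1" using n by (simp_all add: field_simps)
  show \<delta>0: "0 < \<delta>" using n0 by (simp add: \<delta>_def)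
  show \<delta>1: "\<delta> < 1" using n0 by (simp add: \<delta>_def)
  have "\<delta>\<^sup>2 = 1 - 1 / real n" using n0 by (simp add: \<delta>_def)
  hence "(1 - \<delta>) * (1 + \<delta>) = 1 / real n" by (simp add: power2_eq_square algebra_simps)
  \<comment> \<open>This is the condition for the derivative of (1 - n (1 - \<delta>)) (1 -
    \<delta>) / \<delta> in \<delta> to vanish. It brings both the final barrier and 1 / (1 -
    \<delta>) into closed form.\<close>
  hence eq: "real n * ((1 - \<delta>) * (1 + \<delta>)) = 1" using n0 by simp
  hence "real n * (1 - \<delta>) = 1 / (1 + \<delta>)" using \<delta>0 by (simp add: field_simps)
  hence l: "barrier n \<delta> n + 1 = \<delta> / (1 + \<delta>)"
    using \<delta>0 by (simp add: barrier_eq field_simps)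
  thus "0 < barrier n \<delta> n + 1" using \<delta>0 by simp
  have inv: "1 / (1 - \<delta>) = real n * (1 + \<delta>)"
    using eq \<delta>1 by (simp add: field_simps)
  have "real n / ((barrier n \<delta> n + 1) * ((1 - \<delta>) / \<delta>)) = real n * (1 + \<delta>) * (1 / (1 - \<delta>))"
    unfolding l using \<delta>0 \<delta>1 by simp
  also have "\<dots> = (real n * (1 + \<delta>))\<^sup>2" unfolding inv by (simp add: power2_eq_square)
  also have "\<dots> \<le> (real n * 2)\<^sup>2" using \<delta>0 \<delta>1 by (intro power_mono mult_left_mono) auto
  finally show "real n / ((barrier n \<delta> n + 1) * ((1 - \<delta>) / \<delta>)) \<le> (2 * real n)\<^sup>2"
    by (simp add: mult.commute)
qed

lemma le_mult_INF_ennreal: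
  fixes x c :: ennreal and h :: "nat \<Rightarrow> ennreal"
  assumes "\<And>i. x \<le> c * h i" "0 < c" "c < top"
  shows "x \<le> c * (INF i. h i)"
proof -
  have c: "c * inverse c = 1"
    using assms ennreal_divide_self[of c] by (simp add: divide_ennreal_def)
  have "inverse c * x \<le> h i" for i
    using mult_left_mono[OF assms(1)[of i], of "inverse c"] c by (simp add: mult.assoc[symmetric] mult.commute)
  hence "inverse c * x \<le> (INF i. h i)" by (rule INF_greatest)
  hence "c * (inverse c * x) \<le> c * (INF i. h i)" by (rule mult_left_mono) simp
  thus ?thesis using c by (simp add: mult.assoc[symmetric])
qed

theorem corollary1p2:
  fixes M :: "'a measure" and V :: "('a \<Rightarrow> complex) set"
    and \<phi> :: "'a \<Rightarrow> complex ^ 'n" and f :: "'a \<Rightarrow> complex"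
    and n :: nat and \<delta> :: real
  assumes "prob_space M"
    and "n = CARD('n)" and "n \<ge> 2"
    and "L2_subspace M V"
    and "orthonormal_basis M V \<phi>"
    and "f \<in> borel_measurable M"
    and "\<delta> = sqrt (1 - 1 / real n)"
  shows
    "(\<integral>\<^sup>+ xs. (L2norm M (\<lambda>x. f x - sample_approx \<phi> \<delta> 0 n f xs x))\<^sup>2 \<partial>sample_law M \<phi> \<delta> 0 n)
       \<le> (4 * of_nat n ^ 2 + 1) * (INF v\<in>V. (L2norm M (\<lambda>x. f x - v x))\<^sup>2)
     \<and>
     (V \<subseteq> Linf_funs M \<longrightarrow>
       (AE xs in sample_law M \<phi> \<delta> 1 n.
          L2norm M (\<lambda>x. f x - sample_approx \<phi> \<delta> 1 n f xs x)
            \<le> (2 * of_nat n + 1) * (INF v\<in>V. Linfnorm M (\<lambda>x. f x - v x))))"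
proof -
  have V: "V \<subseteq> L2_funs M" "(\<lambda>_. 0) \<in> V" using assms(4) by (auto simp: L2_subspace_def)
  have basis_L2: "(\<lambda>x. \<phi> x $ j) \<in> L2_funs M" for j
    using V(1) assms(5) by (auto simp: orthonormal_basis_def)
  hence [measurable]: "\<phi> \<in> borel_measurable M"
    by (intro borel_measurable_vecI L2_funs_measurable)
  note \<delta> = step_size_facts[OF assms(3,7)]
  have sampler: "orthonormal_sampler M \<phi> \<delta>"
    using assms(1,5) \<delta> basis_L2
    by (intro orthonormal_sampler.intro sampler.intro sampler_axioms.intro orthonormal_sampler_axioms.intro)
       (auto simp: orthonormal_basis_def)
  interpret L2: orthonormal_sampler M \<phi> \<delta> 0 by (rule sampler)
  interpret Linf: orthonormal_sampler M \<phi> \<delta> 1 by (rule sampler)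
  have V_lin_comb: "\<exists>c. AE x in M. v x = lin_comb \<phi> c x" if "v \<in> V" for v
    using assms(5) that by (simp add: orthonormal_basis_def)
  have [measurable]: "f \<in> borel_measurable M" by fact
  have [measurable]: "v \<in> borel_measurable M" if "v \<in> V" for v
    using that V(1) L2_funs_measurable by blast
  have "(\<integral>\<^sup>+ xs. (L2norm M (\<lambda>x. f x - sample_approx \<phi> \<delta> 0 n f xs x))\<^sup>2 \<partial>sample_law M \<phi> \<delta> 0 n)
       \<le> (4 * of_nat n ^ 2 + 1) * (INF v\<in>V. (L2norm M (\<lambda>x. f x - v x))\<^sup>2)"
  proof (cases "f \<in> L2_funs M")
    case True
    \<comment> \<open>Coefficients of the orthogonal projection of f. By Pythagoras
      \<open>lin_comb \<phi> c0\<close> is at least as close to f as any v in V, so a bound by its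
      distance is a bound by the infimum.\<close>
    define c0 :: "complex ^ 'n" where "c0 = (\<chi> j. \<integral>x. f x * cnj (\<phi> x $ j) \<partial>M)"
    define G where "G = (L2norm M (\<lambda>x. f x - lin_comb \<phi> c0 x))\<^sup>2"
    have orth: "(\<integral>x. (f x - lin_comb \<phi> c0 x) * cnj (\<phi> x $ j) \<partial>M) = 0" for j
      unfolding c0_def by (rule L2.projection_orthogonal[OF True])
    have "(\<integral>\<^sup>+ xs. (L2norm M (\<lambda>x. f x - sample_approx \<phi> \<delta> 0 n f xs x))\<^sup>2 \<partial>sample_law M \<phi> \<delta> 0 n)
        \<le> ennreal (1 + real n / ((barrier n \<delta> n + 1) * ((1 - \<delta>) / \<delta>))) * G"
      using L2.expected_error[OF refl True _ orth] \<delta>(3) unfolding assms(2) G_def by simp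
    also have "\<dots> \<le> ennreal (1 + (2 * real n)\<^sup>2) * (INF v\<in>V. (L2norm M (\<lambda>x. f x - v x))\<^sup>2)"
    proof (intro mult_mono ennreal_leI add_left_mono \<delta> INF_greatest)
      fix v assume "v \<in> V"
      then obtain c where c: "AE x in M. v x = lin_comb \<phi> c x" using V_lin_comb by blast
      have "G \<le> G + ennreal ((norm (c - c0))\<^sup>2)" by simp
      also have "\<dots> = (\<integral>\<^sup>+ x. ennreal ((cmod (f x - lin_comb \<phi> c0 x - lin_comb \<phi> (c - c0) x))\<^sup>2) \<partial>M)"
        unfolding G_def L2norm_power2
        by (rule L2.pythagoras[OF L2_funs_diff[OF True L2.lin_comb_L2] orth, symmetric])
      also have "\<dots> = (L2norm M (\<lambda>x. f x - v x))\<^sup>2"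
        unfolding L2norm_power2 lin_comb_diff
        by (intro nn_integral_cong_AE, rule AE_mp[OF c]) auto
      finally show "G \<le> (L2norm M (\<lambda>x. f x - v x))\<^sup>2" .
    qed auto
    also have "ennreal (1 + (2 * real n)\<^sup>2) = 4 * of_nat n ^ 2 + 1"
      by (simp add: ennreal_plus ennreal_mult ennreal_power[symmetric] ennreal_of_nat_eq_real_of_nat
          power_mult_distrib add.commute)
    finally show ?thesis .
  next
    case False
    \<comment> \<open>For f outside L2 every distance to V is infinite, since f is the sum of f - v
      and v; the right side is then infinite as well.\<close>
    have "L2norm M (\<lambda>x. f x - v x) = top" if v: "v \<in> V" for v
    proof (rule ccontr)
      assume "L2norm M (\<lambda>x. f x - v x) \<noteq> top"
      hence "(\<lambda>x. f x - v x) \<in> L2_funs M"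
        using v by (simp add: L2_funs_def less_top)
      from L2_funs_add[OF this, of v] have "f \<in> L2_funs M" using v V(1) by auto
      thus False using False by simp
    qed
    hence "(INF v\<in>V. (L2norm M (\<lambda>x. f x - v x))\<^sup>2) = top" by simp
    thus ?thesis by (simp add: ennreal_mult_top)
  qed
  moreover have "AE xs in sample_law M \<phi> \<delta> 1 n. L2norm M (\<lambda>x. f x - sample_approx \<phi> \<delta> 1 n f xs x)
            \<le> (2 * of_nat n + 1) * (INF v\<in>V. Linfnorm M (\<lambda>x. f x - v x))"
  proof -
    have const: "(2 * of_nat n + 1 :: ennreal) = ennreal (2 * real n + 1)"
      by (simp add: ennreal_plus ennreal_mult ennreal_of_nat_eq_real_of_nat)
    have single: "AE xs in sample_law M \<phi> \<delta> 1 n. L2norm M (\<lambda>x. f x - sample_approx \<phi> \<delta> 1 n f xs x)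
        \<le> (2 * of_nat n + 1) * Linfnorm M (\<lambda>x. f x - v x)" if v: "v \<in> V" for v
    proof (cases "Linfnorm M (\<lambda>x. f x - v x)")
      case (real C)
      obtain c where c: "AE x in M. v x = lin_comb \<phi> c x" using V_lin_comb[OF v] by blast
      have "AE x in M. ennreal (cmod (f x - v x)) \<le> ennreal C"
        using esssup_AE[of "\<lambda>x. ennreal (cmod (f x - v x))" M] real by (simp add: Linfnorm_def)
      with c have bd: "AE x in M. cmod (f x - lin_comb \<phi> c x) \<le> C"
        by eventually_elim (use real in \<open>simp add: ennreal_le_iff\<close>)
      have "AE xs in sample_law M \<phi> \<delta> 1 n. L2norm M (\<lambda>x. f x - sample_approx \<phi> \<delta> 1 n f xs x)
          \<le> ennreal ((2 * real n + 1) * C)"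
        using Linf.sup_error[OF refl assms(6) _ _ _ _ bd, of "real n"] \<delta> assms(3) real
        unfolding assms(2) by simp
      thus ?thesis using real by (simp add: const ennreal_mult)
    next
      case top
      thus ?thesis by (simp add: const ennreal_mult_top)
    qed
    \<comment> \<open>The null set in \<open>single\<close> depends on v, and V may be uncountable.
      Countably many values of the norm with the same infimum need only a countable union of null
      sets.\<close>
    obtain h :: "nat \<Rightarrow> ennreal" where h: "range h \<subseteq> (\<lambda>v. Linfnorm M (\<lambda>x. f x - v x)) ` V"
      "(INF v\<in>V. Linfnorm M (\<lambda>x. f x - v x)) = (INF i. h i)"
      using ennreal_Inf_countable_INF[of "(\<lambda>v. Linfnorm M (\<lambda>x. f x - v x)) ` V"] V(2) by auto
    have "AE xs in sample_law M \<phi> \<delta> 1 n. \<forall>i. L2norm M (\<lambda>x. f x - sample_approx \<phi> \<delta> 1 n f xs x)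
        \<le> (2 * of_nat n + 1) * h i"
      unfolding AE_all_countable
    proof
      fix i
      obtain v where "v \<in> V" "h i = Linfnorm M (\<lambda>x. f x - v x)" using h(1) by blast
      thus "AE xs in sample_law M \<phi> \<delta> 1 n. L2norm M (\<lambda>x. f x - sample_approx \<phi> \<delta> 1 n f xs x)
          \<le> (2 * of_nat n + 1) * h i" using single by simp
    qed
    thus ?thesis
    proof (rule AE_mp, intro AE_I2 impI)
      fix xs assume "\<forall>i. L2norm M (\<lambda>x. f x - sample_approx \<phi> \<delta> 1 n f xs x) \<le> (2 * of_nat n + 1) * h i"
      thus "L2norm M (\<lambda>x. f x - sample_approx \<phi> \<delta> 1 n f xs x)
          \<le> (2 * of_nat n + 1) * (INF v\<in>V. Linfnorm M (\<lambda>x. f x - v x))"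
        unfolding h(2) by (intro le_mult_INF_ennreal) (auto simp: const simp del: ennreal_plus)
    qed
  qed
  ultimately show ?thesis by blast
qed

end
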